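(* The following problem is undecidable: given a time-prefixed hypertrace formula $\varphi=\exists i_1\,\forall i_2\,\exists i_3\,\exists i_4\,\forall i_5\,\forall^T\pi_1\,\exists^T\pi_2\,\exists^T\pi_3\,\exists\pi_4\,\varphi'$ where $i_1,\dots,i_5$ are time variables, $\pi_1,\dots,\pi_4$ are trace variables and $\varphi'$ is quantifier-free, decide whether $\mathcal{L}(\varphi)\neq\emptyset$.
   Context: Fix a finite set $\mathcal{X}$ of propositional variables; a trace is an infinite sequence of subsets of $\mathcal{X}$, $(2^{\mathcal{X}})^\omega$ the set of all traces. Hypertrace formulas over trace variables and disjoint time variables: $\varphi ::= \exists\pi\,\varphi \mid \exists^{T}\pi\,\varphi \mid \exists i\,\varphi \mid \neg\varphi \mid \varphi\vee\varphi \mid i<j \mid i=j \mid x(\pi,i)$, $x\in\mathcal{X}$; $\exists\pi$ is an unconstrained trace quantifier, $\exists^T\pi$ a constrained trace quantifier, $\exists i$ a time quantifier; $\forall x\,\varphi=\neg\exists x\neg\varphi$, $\forall^T\pi\,\varphi=\neg\exists^T\pi\neg\varphi$. Semantics over $T\subseteq(2^{\mathcal{X}})^\omega$ with a trace and a time assignment: $\exists\pi$ ranges over all of $(2^{\mathcal{X}})^\omega$, $\exists^T\pi$ over $T$, $\exists i$ over $\mathbb{N}$; $<,=$ as in $\mathbb{N}$; $x(\pi,i)$ holds iff $x$ belongs to the valuation at position (value of $i$) of the trace assigned to $\pi$. $T\models\varphi$ iff some assignments satisfy $\varphi$ over $T$; $\mathcal{L}(\varphi)=\{T\subseteq(2^{\mathcal{X}})^\omega\mid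 T\models\varphi\}$. Time-prefixed formulas are those generated by $\varphi ::= \exists i\,\varphi\mid\neg\varphi\mid\psi$, $\psi ::= \exists\pi\,\psi\mid\exists^T\pi\,\psi\mid\psi\vee\psi\mid\neg\psi\mid i<j\mid i=j\mid x(\pi,i)$ (all time quantifiers precede all trace quantifiers).
   Formalization: The empty trace set satisfies every such formula, so the question decided is whether some nonempty T lies in L(φ); the finite set X is part of the input, since for one fixed X there are only finitely many inequivalent formulas of this shape. *)

theory Defs
  imports "HOL-Library.Nat_Bijection"
begin

section \<open>Hypertrace logic\<close>

text \<open>
  Propositional, trace and time variables are named by natural numbers. The name spaces are kept
  disjoint by the constructor positions. \<open>ExU\<close> and \<open>ExT\<close> are the
  unconstrained and the constrained trace quantifier.
\<close>

datatype hform =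
    ExU nat hform
  | ExT nat hform
  | ExTime nat hform
  | Neg hform
  | Or hform hform
  | Less nat nat
  | Equal nat nat
  | Holds nat nat nat  \<comment> \<open>\<open>Holds x p i\<close> is $x(p,i)$\<close>

abbreviation AllT :: "nat \<Rightarrow> hform \<Rightarrow> hform" where
  "AllT p \<phi> \<equiv> Neg (ExT p (Neg \<phi>))"

abbreviation AllTime :: "nat \<Rightarrow> hform \<Rightarrow> hform" where
  "AllTime i \<phi> \<equiv> Neg (ExTime i (Neg \<phi>))"

fun props :: "hform \<Rightarrow> nat set" where
  "props (ExU p \<phi>) = props \<phi>"
| "props (ExT p \<phi>) = props \<phi>"
| "props (ExTime i \<phi>) = props \<phi>"
| "props (Neg \<phi>) = props \<phi>"
| "props (Or \<phi> \<psi>) = props \<phi> \<union> props \<psi>"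
| "props (Less i j) = {}"
| "props (Equal i j) = {}"
| "props (Holds x p i) = {x}"

fun free_trace_vars :: "hform \<Rightarrow> nat set" where
  "free_trace_vars (ExU p \<phi>) = free_trace_vars \<phi> - {p}"
| "free_trace_vars (ExT p \<phi>) = free_trace_vars \<phi> - {p}"
| "free_trace_vars (ExTime i \<phi>) = free_trace_vars \<phi>"
| "free_trace_vars (Neg \<phi>) = free_trace_vars \<phi>"
| "free_trace_vars (Or \<phi> \<psi>) = free_trace_vars \<phi> \<union> free_trace_vars \<psi>"
| "free_trace_vars (Less i j) = {}"
| "free_trace_vars (Equal i j) = {}"
| "free_trace_vars (Holds x p i) = {p}"

fun free_time_vars :: "hform \<Rightarrow> nat set" where
  "free_time_vars (ExU p \<phi>) = free_time_vars \<phi>"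
| "free_time_vars (ExT p \<phi>) = free_time_vars \<phi>"
| "free_time_vars (ExTime i \<phi>) = free_time_vars \<phi> - {i}"
| "free_time_vars (Neg \<phi>) = free_time_vars \<phi>"
| "free_time_vars (Or \<phi> \<psi>) = free_time_vars \<phi> \<union> free_time_vars \<psi>"
| "free_time_vars (Less i j) = {i, j}"
| "free_time_vars (Equal i j) = {i, j}"
| "free_time_vars (Holds x p i) = {i}"

definition closed_form :: "hform \<Rightarrow> bool" where
  "closed_form \<phi> \<longleftrightarrow> free_trace_vars \<phi> = {} \<and> free_time_vars \<phi> = {}"

fun quantifier_free :: "hform \<Rightarrow> bool" where
  "quantifier_free (ExU p \<phi>) = False"
| "quantifier_free (ExT p \<phi>) = False"
| "quantifier_free (ExTime i \<phi>) = False"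
| "quantifier_free (Neg \<phi>) = quantifier_free \<phi>"
| "quantifier_free (Or \<phi> \<psi>) = (quantifier_free \<phi> \<and> quantifier_free \<psi>)"
| "quantifier_free (Less i j) = True"
| "quantifier_free (Equal i j) = True"
| "quantifier_free (Holds x p i) = True"

inductive time_quantifier_free :: "hform \<Rightarrow> bool" where
  "time_quantifier_free \<psi> \<Longrightarrow> time_quantifier_free (ExU p \<psi>)"
| "time_quantifier_free \<psi> \<Longrightarrow> time_quantifier_free (ExT p \<psi>)"
| "time_quantifier_free \<psi> \<Longrightarrow> time_quantifier_free \<psi>' \<Longrightarrow> time_quantifier_free (Or \<psi> \<psi>')"
| "time_quantifier_free \<psi> \<Longrightarrow> time_quantifier_free (Neg \<psi>)"
| "time_quantifier_free (Less i j)"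
| "time_quantifier_free (Equal i j)"
| "time_quantifier_free (Holds x p i)"

inductive time_prefixed :: "hform \<Rightarrow> bool" where
  "time_prefixed \<phi> \<Longrightarrow> time_prefixed (ExTime i \<phi>)"
| "time_prefixed \<phi> \<Longrightarrow> time_prefixed (Neg \<phi>)"
| "time_quantifier_free \<psi> \<Longrightarrow> time_prefixed \<psi>"

type_synonym trace = "nat \<Rightarrow> nat set"

definition traces :: "nat set \<Rightarrow> trace set" where
  "traces X = {t. \<forall>n. t n \<subseteq> X}"

fun sat :: "nat set \<Rightarrow> trace set \<Rightarrow> (nat \<Rightarrow> trace) \<Rightarrow> (nat \<Rightarrow> nat) \<Rightarrow> hform \<Rightarrow> bool" where
  "sat X T P I (ExU p \<phi>) \<longleftrightarrow> (\<exists>t\<in>traces X. sat X T (P(p := t)) I \<phi>)"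
| "sat X T P I (ExT p \<phi>) \<longleftrightarrow> (\<exists>t\<in>T. sat X T (P(p := t)) I \<phi>)"
| "sat X T P I (ExTime i \<phi>) \<longleftrightarrow> (\<exists>n. sat X T P (I(i := n)) \<phi>)"
| "sat X T P I (Neg \<phi>) \<longleftrightarrow> \<not> sat X T P I \<phi>"
| "sat X T P I (Or \<phi> \<psi>) \<longleftrightarrow> sat X T P I \<phi> \<or> sat X T P I \<psi>"
| "sat X T P I (Less i j) \<longleftrightarrow> I i < I j"
| "sat X T P I (Equal i j) \<longleftrightarrow> I i = I j"
| "sat X T P I (Holds x p i) \<longleftrightarrow> x \<in> P p (I i)"

definition models :: "nat set \<Rightarrow> trace set \<Rightarrow> hform \<Rightarrow> bool" where
  "models X T \<phi> \<longleftrightarrow> (\<exists>P I. (\<forall>p. P p \<in> traces X) \<and> sat X T P I \<phi>)"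

definition language :: "nat set \<Rightarrow> hform \<Rightarrow> trace set set" where
  "language X \<phi> = {T. T \<subseteq> traces X \<and> models X T \<phi>}"

text \<open>
  The empty trace set satisfies every formula whose first trace quantifier is a constrained
  universal one. For such a prefix, non-emptiness of the language is a meaningful question only
  when the empty trace set is disregarded.
\<close>

lemma empty_in_language:
  "{} \<in> language X (ExTime i\<^sub>1 (AllTime i\<^sub>2 (ExTime i\<^sub>3 (ExTime i\<^sub>4 (AllTime i\<^sub>5 (AllT p \<phi>))))))"
proof -
  have "models X {} (ExTime i\<^sub>1 (AllTime i\<^sub>2 (ExTime i\<^sub>3 (ExTime i\<^sub>4 (AllTime i\<^sub>5 (AllT p \<phi>))))))"
    unfolding models_def
  proof (intro exI conjI)
    show "\<forall>q. (\<lambda>_ _. {}) q \<in> traces X"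
      by (simp add: traces_def)
  qed simp
  then show ?thesis
    by (simp add: language_def)
qed


section \<open>Decidability\<close>

text \<open>
  Partial recursive functions; \<open>eval f xs y\<close> means that \<open>f\<close> is defined on \<open>xs\<close> with value \<open>y\<close>.
  Primitive recursion and minimisation act on the first argument. Arities are not tracked; ill-formed
  applications are undefined.
\<close>

datatype recf =
    Zero
  | Succ
  | Proj nat
  | Comp recf "recf list"
  | PrimRec recf recf
  | Mu recf

inductive eval :: "recf \<Rightarrow> nat list \<Rightarrow> nat \<Rightarrow> bool" where
  Zero: "eval Zero xs 0"
| Succ: "eval Succ [x] (Suc x)"
| Proj: "i < length xs \<Longrightarrow> eval (Proj i) xs (xs ! i)"
| Comp: "list_all2 (\<lambda>g y. eval g xs y) gs ys \<Longrightarrow> eval f ys z \<Longrightarrow> eval (Comp f gs) xs z"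
| PrimRec_0: "eval f xs y \<Longrightarrow> eval (PrimRec f g) (0 # xs) y"
| PrimRec_Suc: "eval (PrimRec f g) (n # xs) r \<Longrightarrow> eval g (n # r # xs) y \<Longrightarrow>
    eval (PrimRec f g) (Suc n # xs) y"
| Mu: "eval f (n # xs) 0 \<Longrightarrow> \<forall>m<n. \<exists>y. eval f (m # xs) (Suc y) \<Longrightarrow> eval (Mu f) xs n"

inductive_cases eval_ZeroE: "eval Zero xs y"
inductive_cases eval_SuccE: "eval Succ xs y"
inductive_cases eval_ProjE: "eval (Proj i) xs y"
inductive_cases eval_CompE: "eval (Comp f gs) xs y"
inductive_cases eval_PrimRec_0E: "eval (PrimRec f g) (0 # xs) y"
inductive_cases eval_PrimRec_SucE: "eval (PrimRec f g) (Suc n # xs) y"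
inductive_cases eval_MuE: "eval (Mu f) xs y"

lemma eval_deterministic: "eval f xs y \<Longrightarrow> eval f xs z \<Longrightarrow> y = z"
proof (induction arbitrary: z rule: eval.induct)
  case (Comp xs gs ys f w)
  from Comp.prems obtain ys' where
    ys': "list_all2 (\<lambda>g y. eval g xs y) gs ys'" and z: "eval f ys' z"
    by (rule eval_CompE)
  have IH: "list_all2 (\<lambda>g y. \<forall>z. eval g xs z \<longrightarrow> y = z) gs ys"
    using Comp.IH(1) by (rule list_all2_mono) simp
  have "ys = ys'"
  proof (rule nth_equalityI)
    show "length ys = length ys'"
      using list_all2_lengthD[OF IH] list_all2_lengthD[OF ys'] by simp
    show "ys ! k = ys' ! k" if "k < length ys" for k
    proof -
      have k: "k < length gs"
        using that list_all2_lengthD[OF IH] by simp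
      show ?thesis
        using list_all2_nthD[OF IH k] list_all2_nthD[OF ys' k] by simp
    qed
  qed
  then show ?case
    using Comp.IH(2) z by simp
next
  case (PrimRec_Suc f g n xs r y)
  from PrimRec_Suc.prems obtain r' where
    "eval (PrimRec f g) (n # xs) r'" and "eval g (n # r' # xs) z"
    by (rule eval_PrimRec_SucE)
  then show ?case
    using PrimRec_Suc.IH by blast
next
  case (Mu f n xs)
  from Mu.prems have z: "eval f (z # xs) 0"
    by (rule eval_MuE)
  from Mu.prems have less_z: "\<forall>m<z. \<exists>y. eval f (m # xs) (Suc y)"
    by (rule eval_MuE)
  have "\<not> z < n"
    using Mu.IH(2) z by blast
  moreover have "\<not> n < z"
    using Mu.IH(1) less_z by blast
  ultimately show ?case
    by simp
next
  case (Zero xs)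
  then show ?case
    by (rule eval_ZeroE) simp
next
  case (Succ x)
  then show ?case
    by (rule eval_SuccE) simp
next
  case (Proj i xs)
  from Proj.prems show ?case
    by (rule eval_ProjE) simp
next
  case (PrimRec_0 f xs y g)
  from PrimRec_0.prems have "eval f xs z"
    by (rule eval_PrimRec_0E)
  then show ?case
    by (rule PrimRec_0.IH)
qed

text \<open>
  A problem consists of instances, an encoding of them as natural numbers and the set of
  yes-instances. A decision procedure has to halt with the right answer on every encoded instance;
  nothing is required of it on other numbers.
\<close>

definition decidable_problem :: "('a \<Rightarrow> nat) \<Rightarrow> 'a set \<Rightarrow> 'a set \<Rightarrow> bool" where
  "decidable_problem enc insts yes \<longleftrightarrow>
     (\<exists>f. \<forall>a\<in>insts. eval f [enc a] (if a \<in> yes then 1 else 0))"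

fun encode_form :: "hform \<Rightarrow> nat" where
  "encode_form (ExU p \<phi>) = prod_encode (0, prod_encode (p, encode_form \<phi>))"
| "encode_form (ExT p \<phi>) = prod_encode (1, prod_encode (p, encode_form \<phi>))"
| "encode_form (ExTime i \<phi>) = prod_encode (2, prod_encode (i, encode_form \<phi>))"
| "encode_form (Neg \<phi>) = prod_encode (3, encode_form \<phi>)"
| "encode_form (Or \<phi> \<psi>) = prod_encode (4, prod_encode (encode_form \<phi>, encode_form \<psi>))"
| "encode_form (Less i j) = prod_encode (5, prod_encode (i, j))"
| "encode_form (Equal i j) = prod_encode (6, prod_encode (i, j))"
| "encode_form (Holds x p i) = prod_encode (7, prod_encode (x, prod_encode (p, i)))"

lemma encode_form_inject: "encode_form \<phi> = encode_form \<psi> \<longleftrightarrow> \<phi> = \<psi>"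
  by (induction \<phi> arbitrary: \<psi>; case_tac \<psi>; simp add: prod_encode_eq)

text \<open>
  The set of propositional variables is part of the instance: over a fixed finite set there are
  only finitely many inequivalent quantifier-free formulas in a fixed finite set of variables.
\<close>

fun encode_instance :: "nat set \<times> hform \<Rightarrow> nat" where
  "encode_instance (X, \<phi>) = prod_encode (set_encode X, encode_form \<phi>)"

lemma inj_on_encode_instance: "inj_on encode_instance {(X, \<phi>). finite X}"
  by (auto simp: inj_on_def encode_form_inject set_encode_eq)

end

theory Submission
  imports Defs
begin

text \<open>
  In a model, every trace carries a unique mark, and every time point is the mark of some trace. A
  trace marked \<open>n\<close> stores the configuration of a deterministic register machine after \<open>n\<close> steps
  (\<open>new\<close>) together with its predecessor (\<open>old\<close>), a register with value \<open>v\<close> being the set of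
  positions below \<open>v\<close>. For time points \<open>a\<close>, \<open>a + 1\<close> and an arbitrary \<open>b\<close>, the sentence demands of a
  trace marked \<open>a + 1\<close> a witness marked \<open>a\<close> whose \<open>new\<close> part agrees at \<open>b\<close> with the \<open>old\<close> part of
  the trace; that \<open>new\<close> results from \<open>old\<close> by one step is a property of the single trace at \<open>0\<close>, \<open>a\<close>,
  \<open>a + 1\<close>, \<open>b\<close>. The witness may vary with \<open>b\<close>, but by induction on \<open>n\<close> all traces marked \<open>n\<close> agree,
  because the machine is deterministic. So the sentence has a nonempty model iff the run never
  reaches a forbidden configuration.

  For undecidability, a decision procedure \<open>f\<close> is applied to itself. Every recursive function has a
  register program. Let \<open>\<phi>\<close> be the formula of the program that computes \<open>f\<close> on the instance built
  from the formula whose code is its input, halting with a nonzero result being forbidden. The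
  instance built from \<open>\<phi>\<close> adds to \<open>\<phi>\<close> a formula that sets the input to the code of \<open>\<phi>\<close>; it has a
  nonempty model iff \<open>f\<close> rejects it.
\<close>

section \<open>Register programs\<close>

text \<open>Each form can be checked on unary register contents by looking at \<open>0\<close>, at
  an arbitrary \<open>b\<close> and at neighbours \<open>a\<close>, \<open>a + 1\<close>, which is
  all that the time prefix offers.\<close>

datatype exp = E0 | E1 | Copy nat | SucOf nat | PredOf nat

fun ev :: "(nat \<Rightarrow> nat) \<Rightarrow> exp \<Rightarrow> nat" where
  "ev s E0 = 0"
| "ev s E1 = 1"
| "ev s (Copy r) = s r"
| "ev s (SucOf r) = Suc (s r)"
| "ev s (PredOf r) = s r - 1"

datatype instr = Asg nat exp | While nat "instr list"

text \<open>
  The control state of a running program is the list of instructions that remain to be executed.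
\<close>

fun tested :: "instr list \<Rightarrow> nat" where
  "tested (While r d # k) = r"
| "tested _ = 0"

fun assigned :: "instr list \<Rightarrow> nat \<Rightarrow> exp" where
  "assigned (Asg r e # k) m = (if m = r then e else Copy m)"
| "assigned _ m = Copy m"

fun nxt :: "instr list \<Rightarrow> bool \<Rightarrow> instr list" where
  "nxt [] z = []"
| "nxt (Asg r e # k) z = k"
| "nxt (While r d # k) z = (if z then k else d @ While r d # k)"

text \<open>The simultaneous assignment to all registers is chosen by the control state alone; the
  zero test affects only the next control state.\<close>

fun step :: "instr list \<times> (nat \<Rightarrow> nat) \<Rightarrow> instr list \<times> (nat \<Rightarrow> nat)" where
  "step (k, s) = (nxt k (s (tested k) = 0), \<lambda>m. ev s (assigned k m))"

text \<open>Quantifying over \<open>k\<close> lets a fragment run in front of any remaining code, in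
  particular in front of the loop that contains it.\<close>

definition exec :: "instr list \<Rightarrow> (nat \<Rightarrow> nat) \<Rightarrow> (nat \<Rightarrow> nat) \<Rightarrow> bool" where
  "exec c s t \<longleftrightarrow> (\<forall>k. \<exists>n. (step ^^ n) (c @ k, s) = (k, t))"

lemma exec_append:
  assumes "exec c s t" "exec d t u"
  shows "exec (c @ d) s u"
  unfolding exec_def
proof
  fix k
  obtain m where m: "(step ^^ m) (c @ (d @ k), s) = (d @ k, t)"
    using assms(1) unfolding exec_def by blast
  obtain n where n: "(step ^^ n) (d @ k, t) = (k, u)"
    using assms(2) unfolding exec_def by blast
  have "(step ^^ (n + m)) ((c @ d) @ k, s) = (k, u)"
    using m n by (simp add: funpow_add)
  then show "\<exists>n. (step ^^ n) ((c @ d) @ k, s) = (k, u)"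
    by blast
qed

lemma exec_Cons: "exec [i] s t \<Longrightarrow> exec d t u \<Longrightarrow> exec (i # d) s u"
  using exec_append[of "[i]" s t d u] by simp

lemma exec_step:
  assumes "\<And>k. step (c @ k, s) = (d @ k, t)" "exec d t u"
  shows "exec c s u"
  unfolding exec_def
proof
  fix k
  obtain n where "(step ^^ n) (d @ k, t) = (k, u)"
    using assms(2) unfolding exec_def by blast
  then have "(step ^^ Suc n) (c @ k, s) = (k, u)"
    using assms(1)[of k] by (simp add: funpow_Suc_right del: funpow.simps)
  then show "\<exists>n. (step ^^ n) (c @ k, s) = (k, u)"
    by blast
qed

lemma exec_Nil: "exec [] s s"
  unfolding exec_def by (auto intro: exI[of _ 0])

lemma exec_Asg: "exec [Asg r e] s (s(r := ev s e))"
  by (rule exec_step[OF _ exec_Nil]) auto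

lemma exec_While_0: "s r = 0 \<Longrightarrow> exec [While r d] s s"
  by (rule exec_step[OF _ exec_Nil]) auto

lemma exec_While_pos:
  assumes "s r \<noteq> 0" "exec d s t" "exec [While r d] t u"
  shows "exec [While r d] s u"
  by (rule exec_step[of _ _ "d @ [While r d]" s])
    (use assms in \<open>auto intro: exec_append\<close>)

section \<open>Compiling recursive functions\<close>

text \<open>Registers from \<open>d\<close> on are scratch space with arbitrary contents.\<close>

definition implements :: "recf \<Rightarrow> nat list \<Rightarrow> nat \<Rightarrow> nat \<Rightarrow> instr list \<Rightarrow> bool" where
  "implements f as out d c \<longleftrightarrow> (\<forall>s y. eval f (map s as) y \<longrightarrow>
     (\<exists>t. exec c s t \<and> t out = y \<and> (\<forall>r<d. r \<noteq> out \<longrightarrow> t r = s r)))"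

lemma implementsD:
  assumes "implements f as out d c" "eval f (map s as) y"
  obtains t where "exec c s t" "t out = y" "\<And>r. r < d \<Longrightarrow> r \<noteq> out \<Longrightarrow> t r = s r"
  using assms unfolding implements_def by blast

lemma implements_args:
  assumes "\<And>g as out d. g \<in> set gs \<Longrightarrow> set as \<subseteq> {..<d} \<Longrightarrow> out < d \<Longrightarrow> \<exists>c. implements g as out d c"
    and "set as \<subseteq> {..<d}"
  shows "\<exists>c. \<forall>s ys. list_all2 (\<lambda>g y. eval g (map s as) y) gs ys \<longrightarrow>
    (\<exists>t. exec c s t \<and> (\<forall>j<length gs. t (d + j) = ys ! j) \<and> (\<forall>r<d. t r = s r))"
  using assms
proof (induction gs arbitrary: d)
  case Nil
  show ?case
    by (rule exI[of _ "[]"]) (auto intro: exec_Nil)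
next
  case (Cons g gs)
  have "set as \<subseteq> {..<Suc d}"
    using Cons.prems(2) by auto
  then obtain c where c: "implements g as d (Suc d) c"
    using Cons.prems(1)[of g as "Suc d" d] by auto
  obtain c' where c': "\<And>s ys. list_all2 (\<lambda>g y. eval g (map s as) y) gs ys \<Longrightarrow>
    \<exists>t. exec c' s t \<and> (\<forall>j<length gs. t (Suc d + j) = ys ! j) \<and> (\<forall>r<Suc d. t r = s r)"
    using Cons.IH[OF Cons.prems(1) \<open>set as \<subseteq> {..<Suc d}\<close>] by auto
  show ?case
  proof (intro exI[of _ "c @ c'"] allI impI)
    fix s ys
    assume "list_all2 (\<lambda>g y. eval g (map s as) y) (g # gs) ys"
    then obtain y ys' where ys: "ys = y # ys'" "eval g (map s as) y"
      "list_all2 (\<lambda>g y. eval g (map s as) y) gs ys'"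
      by (auto simp: list_all2_Cons1)
    obtain t where t: "exec c s t" "t d = y" "\<And>r. r < Suc d \<Longrightarrow> r \<noteq> d \<Longrightarrow> t r = s r"
      using implementsD[OF c ys(2)] by blast
    have "map t as = map s as"
      using t(3) Cons.prems(2) by force
    then have "list_all2 (\<lambda>g y. eval g (map t as) y) gs ys'"
      using ys(3) by (simp only:)
    from c'[OF this] obtain u where u: "exec c' t u"
      "\<forall>j<length gs. u (Suc d + j) = ys' ! j" "\<forall>r<Suc d. u r = t r"
      by blast
    have "u (d + j) = ys ! j" if "j < length (g # gs)" for j
      using that u(2,3) t(2) ys(1) by (cases j) auto
    then show "\<exists>t. exec (c @ c') s t \<and> (\<forall>j<length (g # gs). t (d + j) = ys ! j) \<and>
      (\<forall>r<d. t r = s r)"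
      using exec_append[OF t(1) u(1)] u(3) t(3) by (intro exI[of _ u]) auto
  qed
qed

text \<open>Guarantees that the loop for \<open>PrimRec\<close> never runs a subprogram outside its
  domain.\<close>

lemma eval_PrimRec_le:
  "eval (PrimRec f g) (n # xs) y \<Longrightarrow> m \<le> n \<Longrightarrow> \<exists>v. eval (PrimRec f g) (m # xs) v"
proof (induction n arbitrary: y)
  case 0
  then show ?case by auto
next
  case (Suc n)
  then show ?case
    by (cases "m = Suc n") (auto elim: eval_PrimRec_SucE)
qed

text \<open>Register \<open>d\<close> counts up, \<open>d + 1\<close> holds the value at the
  counter, \<open>d + 2\<close> counts the remaining rounds and \<open>d + 3\<close> receives the
  result of \<open>g\<close>. The argument is copied because registers below \<open>d\<close> other
  than \<open>out\<close> must survive.\<close>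

lemma implements_PrimRec:
  assumes f: "implements f as (d + 1) (d + 2) cf"
    and g: "implements g (d # (d + 1) # as) (d + 3) (d + 4) cg"
    and as: "set (a # as) \<subseteq> {..<d}" and out: "out < d"
  defines "body \<equiv> cg @ [Asg (d + 1) (Copy (d + 3)), Asg d (SucOf d), Asg (d + 2) (PredOf (d + 2))]"
  shows "implements (PrimRec f g) (a # as) out d
    (cf @ Asg d E0 # Asg (d + 2) (Copy a) # While (d + 2) body # [Asg out (Copy (d + 1))])"
  unfolding implements_def
proof (intro allI impI)
  fix s :: "nat \<Rightarrow> nat" and y
  let ?xs = "map s as"
  assume "eval (PrimRec f g) (map s (a # as)) y"
  then have y: "eval (PrimRec f g) (s a # ?xs) y"
    by simp
  have loop: "\<exists>t. exec [While (d + 2) body] u t \<and> t (d + 1) = y \<and> (\<forall>r<d. t r = s r)"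
    if "\<forall>r<d. u r = s r" "eval (PrimRec f g) (u d # ?xs) (u (d + 1))" "u d + u (d + 2) = s a" for u
    using that
  proof (induction "u (d + 2)" arbitrary: u)
    case 0
    then have "u (d + 1) = y"
      using y eval_deterministic by auto
    then show ?case
      using 0 by (intro exI[of _ u]) (auto intro: exec_While_0)
  next
    case (Suc m)
    have "Suc (u d) \<le> s a"
      using Suc.hyps(2) Suc.prems(3) by linarith
    from eval_PrimRec_le[OF y this] obtain v where
      v: "eval (PrimRec f g) (Suc (u d) # ?xs) v" by blast
    then obtain w where "eval (PrimRec f g) (u d # ?xs) w" and gv: "eval g (u d # w # ?xs) v"
      by (rule eval_PrimRec_SucE)
    then have "w = u (d + 1)"
      using Suc.prems(2) eval_deterministic by blast
    moreover have "map u as = ?xs"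
      using Suc.prems(1) as by auto
    ultimately have "map u (d # (d + 1) # as) = u d # w # ?xs"
      by (simp only: list.map)
    then have "eval g (map u (d # (d + 1) # as)) v"
      using gv by (simp only:)
    from implementsD[OF g this] obtain t where
      t: "exec cg u t" "t (d + 3) = v" "\<And>r. r < d + 4 \<Longrightarrow> r \<noteq> d + 3 \<Longrightarrow> t r = u r" by blast
    define t' where "t' = t(d + 1 := v, d := Suc (u d), d + 2 := m)"
    have td: "t d = u d" "t (d + 2) = Suc m"
      using t(3)[of d] t(3)[of "d + 2"] Suc.hyps(2) by auto
    have "exec body u t'"
      unfolding body_def
    proof (rule exec_append[OF t(1)], rule exec_Cons[OF exec_Asg], rule exec_Cons[OF exec_Asg])
      show "exec [Asg (d + 2) (PredOf (d + 2))]
        (t(d + 1 := ev t (Copy (d + 3)), d := ev (t(d + 1 := ev t (Copy (d + 3)))) (SucOf d))) t'"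
        using exec_Asg[of "d + 2" "PredOf (d + 2)"
          "t(d + 1 := ev t (Copy (d + 3)), d := ev (t(d + 1 := ev t (Copy (d + 3)))) (SucOf d))"]
          t(2) td unfolding t'_def by simp
    qed
    moreover have "\<exists>x. exec [While (d + 2) body] t' x \<and> x (d + 1) = y \<and> (\<forall>r<d. x r = s r)"
    proof (rule Suc.hyps(1))
      show "m = t' (d + 2)"
        by (simp add: t'_def)
      show "\<forall>r<d. t' r = s r"
        using t(3) Suc.prems(1) by (auto simp: t'_def)
      show "eval (PrimRec f g) (t' d # ?xs) (t' (d + 1))"
        using v by (simp add: t'_def)
      show "t' d + t' (d + 2) = s a"
        using Suc.hyps(2) Suc.prems(3) by (simp add: t'_def)
    qed
    moreover have "u (d + 2) \<noteq> 0"
      using Suc.hyps(2) by simp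
    ultimately show ?case
      using exec_While_pos by blast
  qed
  obtain y0 where "eval (PrimRec f g) (0 # ?xs) y0"
    using eval_PrimRec_le[OF y, of 0] by auto
  then have "eval f ?xs y0"
    by (rule eval_PrimRec_0E)
  from implementsD[OF f this] obtain t where
    t: "exec cf s t" "t (d + 1) = y0" "\<And>r. r < d + 2 \<Longrightarrow> r \<noteq> d + 1 \<Longrightarrow> t r = s r" by blast
  define u where "u = t(d := 0, d + 2 := t a)"
  have "a < d"
    using as by simp
  have "\<exists>x. exec [While (d + 2) body] u x \<and> x (d + 1) = y \<and> (\<forall>r<d. x r = s r)"
  proof (rule loop)
    show "\<forall>r<d. u r = s r"
      using t(3) by (auto simp: u_def)
    show "eval (PrimRec f g) (u d # ?xs) (u (d + 1))"
      using \<open>eval (PrimRec f g) (0 # ?xs) y0\<close> t(2) by (simp add: u_def)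
    show "u d + u (d + 2) = s a"
      using t(3)[of a] \<open>a < d\<close> by (simp add: u_def)
  qed
  then obtain x where x: "exec [While (d + 2) body] u x" "x (d + 1) = y" "\<forall>r<d. x r = s r"
    by blast
  have "exec (Asg (d + 2) (Copy a) # While (d + 2) body # [Asg out (Copy (d + 1))])
    (t(d := ev t E0)) (x(out := y))"
  proof (rule exec_Cons[OF exec_Asg])
    have "t(d := ev t E0, d + 2 := ev (t(d := ev t E0)) (Copy a)) = u"
      using \<open>a < d\<close> by (simp add: u_def)
    then show "exec (While (d + 2) body # [Asg out (Copy (d + 1))])
      (t(d := ev t E0, d + 2 := ev (t(d := ev t E0)) (Copy a))) (x(out := y))"
      using exec_Cons[OF x(1) exec_Asg[of out "Copy (d + 1)"]] x(2) by simp
  qed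
  from exec_append[OF t(1) exec_Cons[OF exec_Asg this]]
  have "exec (cf @ Asg d E0 # Asg (d + 2) (Copy a) # While (d + 2) body #
    [Asg out (Copy (d + 1))]) s (x(out := y))" .
  then show "\<exists>t. exec (cf @ Asg d E0 # Asg (d + 2) (Copy a) # While (d + 2) body #
    [Asg out (Copy (d + 1))]) s t \<and> t out = y \<and> (\<forall>r<d. r \<noteq> out \<longrightarrow> t r = s r)"
    using x(3) by (intro exI[of _ "x(out := y)"]) auto
qed

text \<open>The candidate sits in \<open>d\<close>, the value of \<open>f\<close> there in
  \<open>d + 1\<close>. The loop stops exactly at \<open>n\<close>, since \<open>f\<close> is
  defined and nonzero at all smaller candidates.\<close>

lemma implements_Mu:
  assumes f: "implements f (d # as) (d + 1) (d + 2) cf"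
    and as: "set as \<subseteq> {..<d}" and out: "out < d"
  defines "body \<equiv> Asg d (SucOf d) # cf"
  shows "implements (Mu f) as out d (Asg d E0 # cf @ While (d + 1) body # [Asg out (Copy d)])"
  unfolding implements_def
proof (intro allI impI)
  fix s :: "nat \<Rightarrow> nat" and n
  let ?xs = "map s as"
  assume "eval (Mu f) ?xs n"
  then have n: "eval f (n # ?xs) 0" and less: "\<And>m. m < n \<Longrightarrow> \<exists>y. eval f (m # ?xs) (Suc y)"
    by (auto elim: eval_MuE)
  have defined: "\<exists>y. eval f (m # ?xs) y" if "m \<le> n" for m
    using that n less by (metis le_neq_implies_less)
  have cf: "\<exists>t. exec cf u t \<and> eval f (t d # ?xs) (t (d + 1)) \<and> t d = u d \<and> (\<forall>r<d. t r = s r)"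
    if u: "\<forall>r<d. u r = s r" "u d \<le> n" for u
  proof -
    obtain y where y: "eval f (u d # ?xs) y"
      using defined u(2) by blast
    have "map u as = ?xs"
      using u(1) as by auto
    then have "map u (d # as) = u d # ?xs"
      by (simp only: list.map)
    then have "eval f (map u (d # as)) y"
      using y by (simp only:)
    from implementsD[OF f this] obtain t where
      t: "exec cf u t" "t (d + 1) = y" "\<And>r. r < d + 2 \<Longrightarrow> r \<noteq> d + 1 \<Longrightarrow> t r = u r" by blast
    then show ?thesis
      using u(1) y by (intro exI[of _ t]) auto
  qed
  have loop: "\<exists>t. exec [While (d + 1) body] u t \<and> t d = n \<and> (\<forall>r<d. t r = s r)"
    if "\<forall>r<d. u r = s r" "eval f (u d # ?xs) (u (d + 1))" "u d \<le> n" for u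
    using that
  proof (induction "n - u d" arbitrary: u)
    case 0
    then have "u d = n"
      by simp
    then have "u (d + 1) = 0"
      using 0 n eval_deterministic by auto
    then show ?case
      using 0 \<open>u d = n\<close> by (intro exI[of _ u]) (auto intro: exec_While_0)
  next
    case (Suc m)
    then have "u d < n"
      by simp
    then obtain y where "eval f (u d # ?xs) (Suc y)"
      using less by blast
    then have "u (d + 1) \<noteq> 0"
      using Suc.prems(2) eval_deterministic by fastforce
    have "\<forall>r<d. (u(d := Suc (u d))) r = s r" "(u(d := Suc (u d))) d \<le> n"
      using Suc.prems(1) \<open>u d < n\<close> by auto
    from cf[OF this, unfolded fun_upd_same] obtain t where t: "exec cf (u(d := Suc (u d))) t"
      "eval f (t d # ?xs) (t (d + 1))" "t d = Suc (u d)" "\<forall>r<d. t r = s r" by blast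
    have "exec body u t"
      unfolding body_def using t(1) exec_Cons[OF exec_Asg[of d "SucOf d" u]] by simp
    moreover have "\<exists>x. exec [While (d + 1) body] t x \<and> x d = n \<and> (\<forall>r<d. x r = s r)"
      by (rule Suc.hyps(1)) (use t Suc.hyps(2) \<open>u d < n\<close> in auto)
    ultimately show ?case
      using exec_While_pos[of u "d + 1"] \<open>u (d + 1) \<noteq> 0\<close> by blast
  qed
  have "\<forall>r<d. (s(d := 0)) r = s r" "(s(d := 0)) d \<le> n"
    by auto
  from cf[OF this, unfolded fun_upd_same] obtain t where t: "exec cf (s(d := 0)) t"
    "eval f (t d # ?xs) (t (d + 1))" "t d = 0" "\<forall>r<d. t r = s r" by blast
  from loop[OF t(4) t(2)] t(3) obtain x where
    x: "exec [While (d + 1) body] t x" "x d = n" "\<forall>r<d. x r = s r" by auto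
  have "exec (While (d + 1) body # [Asg out (Copy d)]) t (x(out := n))"
    using exec_Cons[OF x(1) exec_Asg[of out "Copy d"]] x(2) by simp
  then have "exec (Asg d E0 # cf @ While (d + 1) body # [Asg out (Copy d)]) s (x(out := n))"
    using exec_Cons[OF exec_Asg[of d E0 s]] exec_append[OF t(1)] by simp
  then show "\<exists>t. exec (Asg d E0 # cf @ While (d + 1) body # [Asg out (Copy d)]) s t \<and>
    t out = n \<and> (\<forall>r<d. r \<noteq> out \<longrightarrow> t r = s r)"
    using x(3) by (intro exI[of _ "x(out := n)"]) auto
qed

lemma ex_implements:
  "set as \<subseteq> {..<d} \<Longrightarrow> out < d \<Longrightarrow> \<exists>c. implements f as out d c"
proof (induction f arbitrary: as out d)
  case Zero
  have "implements Zero as out d [Asg out E0]"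
    unfolding implements_def
    by (auto elim!: eval_ZeroE intro!: exI exec_Asg)
  then show ?case ..
next
  case Succ
  have "implements Succ as out d [Asg out (SucOf (hd as))]"
    unfolding implements_def
    by (auto elim!: eval_SuccE intro!: exI[of _ "_(out := _)"] exec_Asg[of _ "SucOf _", simplified])
  then show ?case ..
next
  case (Proj i)
  have "implements (Proj i) as out d [Asg out (Copy (as ! i))]"
    unfolding implements_def
    by (auto elim!: eval_ProjE intro!: exI exec_Asg)
  then show ?case ..
next
  case (Comp f gs)
  obtain c where c: "\<And>s ys. list_all2 (\<lambda>g y. eval g (map s as) y) gs ys \<Longrightarrow>
    \<exists>t. exec c s t \<and> (\<forall>j<length gs. t (d + j) = ys ! j) \<and> (\<forall>r<d. t r = s r)"
    using implements_args[of gs as d] Comp.IH(2) Comp.prems(1) by metis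
  obtain c' where c': "implements f [d..<d + length gs] out (d + length gs) c'"
    using Comp.IH(1)[of "[d..<d + length gs]" "d + length gs" out] Comp.prems(2)
    by (metis atLeastLessThan_upt lessThan_iff set_upt atLeastLessThan_iff subsetI trans_less_add1)
  have "implements (Comp f gs) as out d (c @ c')"
    unfolding implements_def
  proof (intro allI impI)
    fix s y
    assume "eval (Comp f gs) (map s as) y"
    then obtain ys where ys: "list_all2 (\<lambda>g y. eval g (map s as) y) gs ys" "eval f ys y"
      by (rule eval_CompE)
    obtain t where t: "exec c s t" "\<forall>j<length gs. t (d + j) = ys ! j" "\<forall>r<d. t r = s r"
      using c[OF ys(1)] by blast
    have "map t [d..<d + length gs] = ys"
      using t(2) list_all2_lengthD[OF ys(1)] by (intro nth_equalityI) auto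
    then have "eval f (map t [d..<d + length gs]) y"
      using ys(2) by simp
    from implementsD[OF c' this] obtain u where u: "exec c' t u" "u out = y"
      "\<And>r. r < d + length gs \<Longrightarrow> r \<noteq> out \<Longrightarrow> u r = t r" by blast
    then show "\<exists>t. exec (c @ c') s t \<and> t out = y \<and> (\<forall>r<d. r \<noteq> out \<longrightarrow> t r = s r)"
      using exec_append[OF t(1) u(1)] t(3) by (intro exI[of _ u]) auto
  qed
  then show ?case ..
next
  case (PrimRec f g)
  show ?case
  proof (cases as)
    case Nil
    \<comment> \<open>\<open>PrimRec\<close> is undefined on the empty list, so any program
      implements it there.\<close>
    have "implements (PrimRec f g) as out d []"
      unfolding implements_def using Nil by (auto elim: eval.cases)
    then show ?thesis ..
  next
    case (Cons a as')
    have "\<exists>c. implements f as' (d + 1) (d + 2) c"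
      by (rule PrimRec.IH(1)) (use Cons PrimRec.prems in auto)
    moreover have "\<exists>c. implements g (d # (d + 1) # as') (d + 3) (d + 4) c"
      by (rule PrimRec.IH(2)) (use Cons PrimRec.prems in auto)
    ultimately show ?thesis
      using implements_PrimRec PrimRec.prems unfolding Cons by blast
  qed
next
  case (Mu f)
  have "\<exists>c. implements f (d # as) (d + 1) (d + 2) c"
    by (rule Mu.IH) (use Mu.prems in auto)
  then show ?case
    using implements_Mu Mu.prems by blast
qed

section \<open>Finiteness of the set of control states\<close>

text \<open>
  \<open>continuations c k\<close> contains all control states through which \<open>c @ k\<close> passes before
  reaching \<open>k\<close>.
\<close>

fun continuations :: "instr list \<Rightarrow> instr list \<Rightarrow> instr list set" where
  "continuations [] k = {k}"
| "continuations (Asg r e # c) k = insert (Asg r e # c @ k) (continuations c k)"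
| "continuations (While r d # c) k =
    insert (While r d # c @ k) (continuations c k \<union> continuations d (While r d # c @ k))"

lemma finite_continuations: "finite (continuations c k)"
  by (induction c k rule: continuations.induct) auto

lemma start_in_continuations: "c @ k \<in> continuations c k"
  by (cases "(c, k)" rule: continuations.cases) auto

text \<open>A loop body continues with the loop itself, which is already in the set; so a finite set
  is closed under \<open>nxt\<close> although loops may repeat forever. At \<open>k\<close> control
  leaves \<open>c\<close>.\<close>

lemma nxt_in_continuations: "l \<in> continuations c k \<Longrightarrow> l \<noteq> k \<Longrightarrow> nxt l z \<in> continuations c k"
proof (induction c k rule: continuations.induct)
  case (2 r e c k)
  then show ?case
    using start_in_continuations[of c k] by auto
next
  case (3 r d c k)
  then show ?case
    using start_in_continuations[of c k] start_in_continuations[of d "While r d # c @ k"]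
    by (cases "l = While r d # c @ k") auto
qed auto

section \<open>Runs as sets of traces\<close>

definition And :: "hform \<Rightarrow> hform \<Rightarrow> hform" where
  "And \<phi> \<psi> = Neg (Or (Neg \<phi>) (Neg \<psi>))"

definition Differ :: "hform \<Rightarrow> hform \<Rightarrow> hform" where
  "Differ \<phi> \<psi> = Or (And \<phi> (Neg \<psi>)) (And (Neg \<phi>) \<psi>)"

definition Disj :: "hform list \<Rightarrow> hform" where
  "Disj \<phi>s = foldr Or \<phi>s (Less 0 0)"

text \<open>
  Of the variables bound by the sentence below, the time variable 3 and the trace variables 2 and 3
  are dummies. Since a matrix has no quantifiers, the set arguments \<open>{}\<close> in \<open>holds\<close> are irrelevant.
\<close>

fun matrix :: "hform \<Rightarrow> bool" where
  "matrix (ExU p \<phi>) = False"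
| "matrix (ExT p \<phi>) = False"
| "matrix (ExTime i \<phi>) = False"
| "matrix (Neg \<phi>) = matrix \<phi>"
| "matrix (Or \<phi> \<psi>) = (matrix \<phi> \<and> matrix \<psi>)"
| "matrix (Less i j) = ({i, j} \<subseteq> {0, 1, 2, 4})"
| "matrix (Equal i j) = ({i, j} \<subseteq> {0, 1, 2, 4})"
| "matrix (Holds x p i) = (p \<in> {0, 1} \<and> i \<in> {0, 1, 2, 4})"

lemma matrix_quantifier_free: "matrix \<phi> \<Longrightarrow> quantifier_free \<phi>"
  by (induction \<phi>) auto

lemma matrix_free_trace_vars: "matrix \<phi> \<Longrightarrow> free_trace_vars \<phi> \<subseteq> {0, 1}"
  by (induction \<phi>) auto

lemma matrix_free_time_vars: "matrix \<phi> \<Longrightarrow> free_time_vars \<phi> \<subseteq> {0, 1, 2, 4}"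
  by (induction \<phi>) auto

definition holds :: "hform \<Rightarrow> trace \<Rightarrow> trace \<Rightarrow> nat \<Rightarrow> nat \<Rightarrow> nat \<Rightarrow> nat \<Rightarrow> bool" where
  "holds \<phi> t u c a a' b \<longleftrightarrow> sat {} {} (\<lambda>p. if p = 0 then t else u)
     (\<lambda>i. if i = 0 then c else if i = 1 then a else if i = 2 then a' else b) \<phi>"

lemma holds_simps [simp]:
  "holds (Neg \<phi>) t u c a a' b \<longleftrightarrow> \<not> holds \<phi> t u c a a' b"
  "holds (Or \<phi> \<psi>) t u c a a' b \<longleftrightarrow> holds \<phi> t u c a a' b \<or> holds \<psi> t u c a a' b"
  "holds (And \<phi> \<psi>) t u c a a' b \<longleftrightarrow> holds \<phi> t u c a a' b \<and> holds \<psi> t u c a a' b"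
  "holds (Differ \<phi> \<psi>) t u c a a' b \<longleftrightarrow> holds \<phi> t u c a a' b \<noteq> holds \<psi> t u c a a' b"
  by (auto simp: holds_def And_def Differ_def)

lemma holds_Disj [simp]:
  "holds (Disj \<phi>s) t u c a a' b \<longleftrightarrow> (\<exists>\<phi>\<in>set \<phi>s. holds \<phi> t u c a a' b)"
  by (induction \<phi>s) (auto simp: holds_def Disj_def)

lemma matrix_simps [simp]:
  "matrix (And \<phi> \<psi>) \<longleftrightarrow> matrix \<phi> \<and> matrix \<psi>"
  "matrix (Differ \<phi> \<psi>) \<longleftrightarrow> matrix \<phi> \<and> matrix \<psi>"
  by (auto simp: And_def Differ_def)

lemma matrix_Disj [simp]: "matrix (Disj \<phi>s) \<longleftrightarrow> (\<forall>\<phi>\<in>set \<phi>s. matrix \<phi>)"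
  by (induction \<phi>s) (auto simp: Disj_def)

lemma props_simps [simp]:
  "props (And \<phi> \<psi>) = props \<phi> \<union> props \<psi>"
  "props (Differ \<phi> \<psi>) = props \<phi> \<union> props \<psi>"
  by (auto simp: And_def Differ_def)

lemma props_Disj [simp]: "props (Disj \<phi>s) = (\<Union>\<phi>\<in>set \<phi>s. props \<phi>)"
  by (induction \<phi>s) (auto simp: Disj_def)

lemma sat_eq_holds:
  "matrix \<phi> \<Longrightarrow>
    sat X T P I \<phi> \<longleftrightarrow> holds \<phi> (P 0) (P 1) (I 0) (I 1) (I 2) (I 4)"
  by (induction \<phi>) (auto simp: holds_def)

definition sentence :: "hform \<Rightarrow> hform" where
  "sentence \<phi> = ExTime 0 (AllTime 1 (ExTime 2 (ExTime 3 (AllTime 4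
     (AllT 0 (ExT 1 (ExT 2 (ExU 3 \<phi>))))))))"

text \<open>The dummy quantifiers vanish because \<open>T\<close>, \<open>traces X\<close> and the
  time domain are nonempty. What matters is the order: \<open>a'\<close> is chosen before
  \<open>b\<close> and \<open>t\<close>, the witness \<open>u\<close> after them.\<close>

lemma sentence_nonempty_iff:
  assumes "matrix \<phi>"
  shows "(\<exists>T\<in>language X (sentence (Neg \<phi>)). T \<noteq> {}) \<longleftrightarrow>
    (\<exists>T. T \<subseteq> traces X \<and> T \<noteq> {} \<and>
      (\<exists>c. \<forall>a. \<exists>a'. \<forall>b. \<forall>t\<in>T. \<exists>u\<in>T. \<not> holds \<phi> t u c a a' b))"
proof -
  have empty: "(\<lambda>_. {}) \<in> traces X"
    by (simp add: traces_def)
  then have ex: "\<exists>t. t \<in> traces X"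
    by blast
  have sat: "sat X T P I (sentence (Neg \<phi>)) \<longleftrightarrow>
      (\<exists>c. \<forall>a. \<exists>a'. \<forall>b. \<forall>t\<in>T. \<exists>u\<in>T. \<not> holds \<phi> t u c a a' b)" if "T \<noteq> {}" for T P I
  proof -
    have "\<exists>t. t \<in> T"
      using that by blast
    with ex show ?thesis
      by (simp add: sentence_def sat_eq_holds[OF assms])
  qed
  have "models X T (sentence (Neg \<phi>)) \<longleftrightarrow>
      (\<exists>c. \<forall>a. \<exists>a'. \<forall>b. \<forall>t\<in>T. \<exists>u\<in>T. \<not> holds \<phi> t u c a a' b)" if "T \<noteq> {}" for T
    unfolding models_def sat[OF that] using empty by (auto intro: exI[of _ "\<lambda>_ _. {}"])
  then have "T \<in> language X (sentence (Neg \<phi>)) \<and> T \<noteq> {} \<longleftrightarrow> T \<subseteq> traces X \<and> T \<noteq> {} \<and>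
      (\<exists>c. \<forall>a. \<exists>a'. \<forall>b. \<forall>t\<in>T. \<exists>u\<in>T. \<not> holds \<phi> t u c a a' b)" for T
    by (cases "T = {}") (simp_all add: language_def)
  then show ?thesis
    by (simp only: Bex_def)
qed

lemma sentence_closed:
  assumes "matrix \<phi>"
  shows "closed_form (sentence (Neg \<phi>))"
  using matrix_free_trace_vars[OF assms] matrix_free_time_vars[OF assms]
  by (auto simp: closed_form_def sentence_def)

lemma quantifier_free_time_quantifier_free: "quantifier_free \<phi> \<Longrightarrow> time_quantifier_free \<phi>"
  by (induction \<phi>) (auto intro: time_quantifier_free.intros)

lemma sentence_time_prefixed:
  assumes "matrix \<phi>"
  shows "time_prefixed (sentence (Neg \<phi>))"
  unfolding sentence_def
  by (intro time_prefixed.intros(1,2) time_prefixed.intros(3)[OF time_quantifier_free.intros(4)]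
      time_quantifier_free.intros quantifier_free_time_quantifier_free
      matrix_quantifier_free assms)

section \<open>Unary registers and single machine steps\<close>

abbreviation (input) "origin \<equiv> 0 :: nat"
abbreviation (input) "now \<equiv> 1 :: nat"
abbreviation (input) "later \<equiv> 2 :: nat"
abbreviation (input) "anywhere \<equiv> 4 :: nat"

text \<open>Residues modulo 4 keep the families apart; linear names put \<open>inp j\<close> for all
  \<open>j\<close> up to \<open>x\<close> below \<open>4 * x + 4\<close>, the bound used in
  \<open>diagonal\<close>.\<close>

definition mark :: nat where "mark = 0"
definition new :: "nat \<Rightarrow> nat" where "new r = 4 * r + 1"
definition old :: "nat \<Rightarrow> nat" where "old r = 4 * r + 2"
definition inp :: "nat \<Rightarrow> nat" where "inp r = 4 * r + 3"

lemma prop_names_eq [simp]: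
  "new r = new m \<longleftrightarrow> r = m" "old r = old m \<longleftrightarrow> r = m" "inp r = inp m \<longleftrightarrow> r = m"
  "mark \<noteq> new r" "mark \<noteq> old r" "mark \<noteq> inp r" "new r \<noteq> mark" "old r \<noteq> mark" "inp r \<noteq> mark"
  "new r \<noteq> old m" "new r \<noteq> inp m" "old r \<noteq> inp m" "old r \<noteq> new m" "inp r \<noteq> new m" "inp r \<noteq> old m"
  unfolding mark_def new_def old_def inp_def by presburger+

definition reads :: "trace \<Rightarrow> nat \<Rightarrow> nat \<Rightarrow> bool" where
  "reads t p v \<longleftrightarrow> (\<forall>i. p \<in> t i \<longleftrightarrow> i < v)"

lemma reads_Suc: "reads t p (Suc v) \<longleftrightarrow> p \<in> t 0 \<and> (\<forall>i. p \<in> t (Suc i) \<longleftrightarrow> i < v)"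
proof -
  have "(\<forall>i. Q i) \<longleftrightarrow> Q 0 \<and> (\<forall>i. Q (Suc i))" for Q :: "nat \<Rightarrow> bool"
    by (metis nat.exhaust)
  from this[of "\<lambda>i. p \<in> t i \<longleftrightarrow> i < Suc v"] show ?thesis
    by (simp add: reads_def)
qed

fun exp_regs :: "exp \<Rightarrow> nat set" where
  "exp_regs (Copy r) = {r}"
| "exp_regs (SucOf r) = {r}"
| "exp_regs (PredOf r) = {r}"
| "exp_regs _ = {}"

lemma ev_cong: "(\<And>r. r \<in> exp_regs e \<Longrightarrow> s r = s' r) \<Longrightarrow> ev s e = ev s' e"
  by (cases e) auto

text \<open>
  Formulas named \<open>wrong\<close> describe violations: a sentence asserts their negation at all time points.
\<close>

fun wrong :: "nat \<Rightarrow> exp \<Rightarrow> hform" where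
  "wrong m E0 = Holds (new m) 0 anywhere"
| "wrong m E1 = Differ (Holds (new m) 0 anywhere) (Equal anywhere origin)"
| "wrong m (Copy r) = Differ (Holds (new m) 0 anywhere) (Holds (old r) 0 anywhere)"
| "wrong m (SucOf r) = Or (Neg (Holds (new m) 0 origin))
     (Differ (Holds (new m) 0 later) (Holds (old r) 0 now))"
| "wrong m (PredOf r) = Differ (Holds (new m) 0 now) (Holds (old r) 0 later)"

lemma matrix_wrong [simp]: "matrix (wrong m e)"
  by (cases e) auto

lemma holds_atom [simp]:
  "holds (Holds x p i) t u c a a' b \<longleftrightarrow> x \<in> (if p = 0 then t else u)
     (if i = 0 then c else if i = 1 then a else if i = 2 then a' else b)"
  "holds (Equal i j) t u c a a' b \<longleftrightarrow>
     (if i = 0 then c else if i = 1 then a else if i = 2 then a' else b) =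
     (if j = 0 then c else if j = 1 then a else if j = 2 then a' else b)"
  "holds (Less i j) t u c a a' b \<longleftrightarrow>
     (if i = 0 then c else if i = 1 then a else if i = 2 then a' else b) <
     (if j = 0 then c else if j = 1 then a else if j = 2 then a' else b)"
  by (auto simp: holds_def)

text \<open>Letting \<open>a\<close> and \<open>b\<close> range over all positions turns local
  checks into equality of unary sets. The shift for \<open>SucOf\<close> misses position 0, which is
  checked separately; for \<open>PredOf\<close>, \<open>a < v - 1\<close> iff
  \<open>a + 1 < v\<close>, also at \<open>v = 0\<close>.\<close>

lemma holds_wrong:
  assumes "\<And>r. r \<in> exp_regs e \<Longrightarrow> reads t (old r) (s r)"
  shows "(\<forall>a b. \<not> holds (wrong m e) t u 0 a (Suc a) b) \<longleftrightarrow> reads t (new m) (ev s e)"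
proof (cases e)
  case (SucOf r)
  have "old r \<in> t a \<longleftrightarrow> a < s r" for a
    using assms[of r] SucOf by (simp add: reads_def)
  then show ?thesis
    by (auto simp: SucOf reads_Suc)
next
  case (PredOf r)
  have "old r \<in> t a \<longleftrightarrow> a < s r" for a
    using assms[of r] PredOf by (simp add: reads_def)
  then show ?thesis
    by (simp add: PredOf reads_def less_diff_conv)
qed (use assms in \<open>auto simp: reads_def\<close>)

text \<open>
  The control state is stored one-hot in the registers from \<open>K\<close> on, one for each element of the
  list \<open>ks\<close> of all control states; all registers of the program are below \<open>K\<close>.
\<close>

definition store :: "instr list list \<Rightarrow> nat \<Rightarrow> instr list \<times> (nat \<Rightarrow> nat) \<Rightarrow> nat \<Rightarrow> nat" where
  "store ks K cfg m =
     (if m < K then snd cfg m else if ks ! (m - K) = fst cfg then 1 else 0)"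

definition update :: "instr list list \<Rightarrow> nat \<Rightarrow> instr list \<Rightarrow> bool \<Rightarrow> nat \<Rightarrow> exp" where
  "update ks K k z m =
     (if m < K then assigned k m else if ks ! (m - K) = nxt k z then E1 else E0)"

text \<open>A unary register contains position 0 iff it is positive, so both the control flag and
  the zero test are read at the origin.\<close>

definition wrong_step :: "instr list list \<Rightarrow> nat \<Rightarrow> hform" where
  "wrong_step ks K = Disj [And (Holds (old (K + j)) 0 origin)
     (Or (And (Neg (Holds (old (tested (ks ! j))) 0 origin))
            (Disj [wrong m (update ks K (ks ! j) True m). m \<leftarrow> [0..<K + length ks]]))
         (And (Holds (old (tested (ks ! j))) 0 origin)
            (Disj [wrong m (update ks K (ks ! j) False m). m \<leftarrow> [0..<K + length ks]]))).
     j \<leftarrow> [0..<length ks]]"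

definition wf_states :: "instr list list \<Rightarrow> nat \<Rightarrow> bool" where
  "wf_states ks K \<longleftrightarrow> distinct ks \<and> (\<forall>k\<in>set ks. \<forall>z. nxt k z \<in> set ks) \<and>
     (\<forall>k\<in>set ks. tested k < K \<and> (\<forall>m<K. exp_regs (assigned k m) \<subseteq> {..<K}))"

text \<open>Since \<open>ks\<close> is distinct, exactly one \<open>old\<close> flag is set; only
  the update of the current control state can be violated, and \<open>holds_wrong\<close> applies
  register by register.\<close>

lemma holds_wrong_step:
  assumes wf: "wf_states ks K" and k: "fst cfg \<in> set ks"
    and old: "\<And>m. m < K + length ks \<Longrightarrow> reads t (old m) (store ks K cfg m)"
  shows "(\<forall>a b. \<not> holds (wrong_step ks K) t u 0 a (Suc a) b) \<longleftrightarrow>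
    (\<forall>m<K + length ks. reads t (new m) (store ks K (step cfg) m))"
proof -
  obtain k s where cfg: "cfg = (k, s)"
    by (cases cfg)
  define z where "z \<longleftrightarrow> s (tested k) = 0"
  obtain j where j: "j < length ks" "ks ! j = k"
    using k cfg by (auto simp: in_set_conv_nth)
  have flag: "old (K + i) \<in> t 0 \<longleftrightarrow> i = j" if "i < length ks" for i
    using old[of "K + i"] that j wf
    by (auto simp: reads_def store_def cfg wf_states_def nth_eq_iff_index_eq)
  have "tested k < K"
    using wf k cfg by (auto simp: wf_states_def)
  then have test: "old (tested k) \<in> t 0 \<longleftrightarrow> \<not> z"
    using old[of "tested k"] by (simp add: reads_def store_def cfg z_def)
  have "holds (wrong_step ks K) t u 0 a (Suc a) b \<longleftrightarrow>
    (\<exists>m<K + length ks. holds (wrong m (update ks K k z m)) t u 0 a (Suc a) b)" for a b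
    unfolding wrong_step_def using j flag test by (cases z) auto
  moreover have "(\<forall>a b. \<not> holds (wrong m (update ks K k z m)) t u 0 a (Suc a) b) \<longleftrightarrow>
    reads t (new m) (store ks K (step cfg) m)" if "m < K + length ks" for m
  proof -
    have regs: "exp_regs (update ks K k z m) \<subseteq> {..<K}"
      using wf k cfg by (auto simp: update_def wf_states_def)
    have "reads t (old r) (store ks K cfg r)" if "r \<in> exp_regs (update ks K k z m)" for r
      using old[of r] that regs by auto
    from holds_wrong[of "update ks K k z m" t "store ks K cfg", OF this]
    have "(\<forall>a b. \<not> holds (wrong m (update ks K k z m)) t u 0 a (Suc a) b) \<longleftrightarrow>
      reads t (new m) (ev (store ks K cfg) (update ks K k z m))" .
    \<comment> \<open>Updates read only program registers, where \<open>store\<close> agrees with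
      \<open>s\<close>.\<close>
    also have "ev (store ks K cfg) (update ks K k z m) = ev s (update ks K k z m)"
      using regs by (intro ev_cong) (auto simp: store_def cfg)
    also have "ev s (update ks K k z m) = store ks K (step cfg) m"
      by (simp add: update_def store_def cfg z_def)
    finally show ?thesis .
  qed
  ultimately show ?thesis
    by meson
qed

section \<open>The formulas for a program and its input\<close>

definition copy_wrong :: "nat \<Rightarrow> hform" where
  "copy_wrong M = Disj [Differ (Holds (old m) 0 anywhere) (Holds (new m) 1 anywhere). m \<leftarrow> [0..<M]]"

definition start_value :: "instr list list \<Rightarrow> nat \<Rightarrow> instr list \<Rightarrow> nat \<Rightarrow> exp" where
  "start_value ks K c m = (if K \<le> m \<and> ks ! (m - K) = c then E1 else E0)"

text \<open>Register 0 is left out: it is initialised by \<open>input_wrong\<close>.\<close>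

definition start_wrong :: "instr list list \<Rightarrow> nat \<Rightarrow> instr list \<Rightarrow> hform" where
  "start_wrong ks K c = Disj [wrong m (start_value ks K c m). m \<leftarrow> [1..<K + length ks]]"

definition halted :: "instr list list \<Rightarrow> nat \<Rightarrow> hform" where
  "halted ks K = Disj [Holds (new (K + j)) 0 origin. j \<leftarrow> filter (\<lambda>j. ks ! j = []) [0..<length ks]]"

text \<open>The first three disjuncts force \<open>origin\<close> to be 0 and \<open>later\<close>
  to follow \<open>now\<close> immediately. A witness marked \<open>now\<close> is demanded of every
  trace, whatever its own mark, so that all time points become marks. Register 1 is the
  output.\<close>

definition program_wrong :: "instr list list \<Rightarrow> nat \<Rightarrow> instr list \<Rightarrow> hform" where
  "program_wrong ks K c = Disj
    [Less anywhere origin,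
     Neg (Less now later),
     And (Less now anywhere) (Less anywhere later),
     And (Holds mark 0 now) (And (Holds mark 0 anywhere) (Neg (Equal now anywhere))),
     Neg (Holds mark 1 now),
     And (Holds mark 0 later) (copy_wrong (K + length ks)),
     And (Holds mark 0 origin) (start_wrong ks K c),
     And (Neg (Holds mark 0 origin)) (wrong_step ks K),
     And (halted ks K) (Holds (new 1) 0 origin)]"

text \<open>The constant \<open>x\<close> is built up by successors from 0, one proposition per
  stage. The recursion on \<open>x\<close> lets \<open>recursive_in_rec\<close> compute the code of
  the formula from \<open>x\<close>.\<close>

fun chain_wrong :: "nat \<Rightarrow> hform" where
  "chain_wrong 0 = Holds (inp 0) 0 anywhere"
| "chain_wrong (Suc j) = Or
     (Or (Neg (Holds (inp (Suc j)) 0 origin))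
         (Differ (Holds (inp (Suc j)) 0 later) (Holds (inp j) 0 now)))
     (chain_wrong j)"

definition input_wrong :: "nat \<Rightarrow> hform" where
  "input_wrong x = Or
     (And (Holds mark 0 origin) (Differ (Holds (new 0) 0 anywhere) (Holds (inp x) 0 anywhere)))
     (chain_wrong x)"

lemma matrix_chain_wrong [simp]: "matrix (chain_wrong j)"
  by (induction j) auto

lemma matrix_input_wrong [simp]: "matrix (input_wrong x)"
  by (simp add: input_wrong_def)

lemma matrix_program_wrong [simp]: "matrix (program_wrong ks K c)"
  by (auto simp: program_wrong_def wrong_step_def copy_wrong_def start_wrong_def halted_def)

lemma holds_program_wrong:
  "\<not> holds (program_wrong ks K c) t u 0 a (Suc a) b \<longleftrightarrow>
    (mark \<in> t a \<and> mark \<in> t b \<longrightarrow> a = b) \<and> mark \<in> u a \<and>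
    (mark \<in> t (Suc a) \<longrightarrow> (\<forall>m<K + length ks. old m \<in> t b \<longleftrightarrow> new m \<in> u b)) \<and>
    (mark \<in> t 0 \<longrightarrow> (\<forall>m\<in>{1..<K + length ks}.
      \<not> holds (wrong m (start_value ks K c m)) t u 0 a (Suc a) b)) \<and>
    (mark \<notin> t 0 \<longrightarrow> \<not> holds (wrong_step ks K) t u 0 a (Suc a) b) \<and>
    \<not> ((\<exists>j<length ks. ks ! j = [] \<and> new (K + j) \<in> t 0) \<and> new 1 \<in> t 0)"
proof -
  have "holds (copy_wrong (K + length ks)) t u 0 a (Suc a) b \<longleftrightarrow>
    \<not> (\<forall>m<K + length ks. old m \<in> t b \<longleftrightarrow> new m \<in> u b)"
    by (auto simp: copy_wrong_def)
  moreover have "holds (start_wrong ks K c) t u 0 a (Suc a) b \<longleftrightarrow>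
    \<not> (\<forall>m\<in>{1..<K + length ks}. \<not> holds (wrong m (start_value ks K c m)) t u 0 a (Suc a) b)"
    by (auto simp: start_wrong_def)
  moreover have "holds (halted ks K) t u 0 a (Suc a) b \<longleftrightarrow>
    (\<exists>j<length ks. ks ! j = [] \<and> new (K + j) \<in> t 0)"
    by (auto simp: halted_def)
  moreover have "\<not> (a < b \<and> b < Suc a)"
    by simp
  ultimately show ?thesis
    by (simp add: program_wrong_def del: not_all not_ex) argo
qed

text \<open>The witness \<open>u\<close> may change with \<open>a\<close> and \<open>b\<close>.
  Formulas that speak about \<open>t\<close> alone allow it to be exchanged for a fixed trace, after
  which \<open>a\<close> and \<open>b\<close> can be quantified.\<close>

lemma holds_wrong_cong: "holds (wrong m e) t u c a a' b = holds (wrong m e) t u' c a a' b"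
  by (cases e) auto

lemma holds_wrong_step_cong:
  "holds (wrong_step ks K) t u c a a' b = holds (wrong_step ks K) t u' c a a' b"
  unfolding wrong_step_def by (simp add: holds_wrong_cong[of _ _ t u _ _ _ _ u'])

lemma holds_chain_wrong_cong:
  "holds (chain_wrong x) t u c a a' b = holds (chain_wrong x) t u' c a a' b"
  by (induction x) auto

lemma holds_chain_wrong:
  "(\<forall>a b. \<not> holds (chain_wrong x) t u 0 a (Suc a) b) \<longleftrightarrow> (\<forall>j\<le>x. reads t (inp j) j)"
proof (induction x)
  case 0
  then show ?case
    by (auto simp: reads_def)
next
  case (Suc x)
  have "(\<forall>a b. \<not> holds (chain_wrong (Suc x)) t u 0 a (Suc a) b) \<longleftrightarrow>
    (\<forall>j\<le>x. reads t (inp j) j) \<and> inp (Suc x) \<in> t 0 \<and>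
    (\<forall>a. inp (Suc x) \<in> t (Suc a) \<longleftrightarrow> inp x \<in> t a)"
    unfolding Suc[symmetric] by auto
  also have "\<dots> \<longleftrightarrow> (\<forall>j\<le>x. reads t (inp j) j) \<and> reads t (inp (Suc x)) (Suc x)"
    unfolding reads_Suc by (auto simp: reads_def)
  finally show ?case
    by (auto simp: le_Suc_eq)
qed

lemma props_chain_wrong: "props (chain_wrong x) = inp ` {..x}"
  by (induction x) (auto simp: atMost_Suc)

lemma program_input_nonempty_iff:
  assumes wf: "wf_states ks K" and c: "c \<in> set ks" and K: "2 \<le> K"
    and X: "props (Or (program_wrong ks K c) (input_wrong x)) \<subseteq> X"
  defines "cfg \<equiv> \<lambda>n. (step ^^ n) (c, (\<lambda>_. 0)(0 := x))"
  shows "(\<exists>T\<in>language X (sentence (Neg (Or (program_wrong ks K c) (input_wrong x)))). T \<noteq> {}) \<longleftrightarrow>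
    (\<forall>n. fst (cfg n) = [] \<longrightarrow> snd (cfg n) 1 = 0)"
    (is "?L \<longleftrightarrow> ?R")
proof -
  let ?M = "K + length ks"
  let ?V = "Or (program_wrong ks K c) (input_wrong x)"
  define S where "S n = store ks K (cfg n)" for n
  have cfg_Suc: "cfg (Suc n) = step (cfg n)" for n
    by (simp add: cfg_def)
  have state: "fst (cfg n) \<in> set ks" for n
  proof (induction n)
    case 0
    then show ?case
      using c by (simp add: cfg_def)
  next
    case (Suc n)
    then show ?case
      using wf unfolding cfg_Suc wf_states_def by (cases "cfg n") auto
  qed
  have S_0: "S 0 0 = x" "\<And>m. 0 < m \<Longrightarrow> S 0 m = ev s (start_value ks K c m)" for s
    using K by (auto simp: S_def store_def cfg_def start_value_def)
  have init: "(\<forall>a b. \<not> holds (wrong m (start_value ks K c m)) t u 0 a (Suc a) b) \<longleftrightarrow>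
    reads t (new m) (S 0 m)" if "0 < m" for m t u
    unfolding S_0(2)[OF that, of "\<lambda>_. 0"]
    by (rule holds_wrong) (simp add: start_value_def split: if_splits)
  have bad: "(\<exists>j<length ks. ks ! j = [] \<and> new (K + j) \<in> t 0) \<and> new 1 \<in> t 0 \<longleftrightarrow>
    \<not> (fst (cfg n) = [] \<longrightarrow> snd (cfg n) 1 = 0)"
    if "\<forall>m<?M. reads t (new m) (S n m)" for t n
  proof -
    have "new (K + j) \<in> t 0 \<longleftrightarrow> ks ! j = fst (cfg n)" if "j < length ks" for j
      using \<open>\<forall>m<?M. _ m\<close>[rule_format, of "K + j"] that by (simp add: reads_def S_def store_def)
    moreover have "new 1 \<in> t 0 \<longleftrightarrow> snd (cfg n) 1 \<noteq> 0"
      using that[rule_format, of 1] K by (simp add: reads_def S_def store_def)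
    ultimately show ?thesis
      using state[of n] by (auto simp: in_set_conv_nth)
  qed
  have V: "\<not> holds ?V t u 0 a (Suc a) b \<longleftrightarrow>
      \<not> holds (program_wrong ks K c) t u 0 a (Suc a) b \<and>
      (mark \<in> t 0 \<longrightarrow> (new 0 \<in> t b \<longleftrightarrow> inp x \<in> t b)) \<and>
      \<not> holds (chain_wrong x) t u 0 a (Suc a) b" for t u a b
    by (auto simp: input_wrong_def)
  have "?L \<longleftrightarrow> (\<exists>T. T \<subseteq> traces X \<and> T \<noteq> {} \<and>
      (\<exists>c. \<forall>a. \<exists>a'. \<forall>b. \<forall>t\<in>T. \<exists>u\<in>T. \<not> holds ?V t u c a a' b))"
    by (rule sentence_nonempty_iff) simp
  also have "\<dots> \<longleftrightarrow> ?R"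
  proof
    assume "\<exists>T. T \<subseteq> traces X \<and> T \<noteq> {} \<and>
      (\<exists>c. \<forall>a. \<exists>a'. \<forall>b. \<forall>t\<in>T. \<exists>u\<in>T. \<not> holds ?V t u c a a' b)"
    then obtain T c0 where T: "T \<noteq> {}"
      and ex: "\<forall>a. \<exists>a'. \<forall>b. \<forall>t\<in>T. \<exists>u\<in>T. \<not> holds ?V t u c0 a a' b"
      by blast
    obtain t0 where t0: "t0 \<in> T"
      using T by blast
    \<comment> \<open>At \<open>b = 0\<close> the disjunct \<open>Less anywhere origin\<close>
      excludes a positive \<open>c0\<close>.\<close>
    obtain a' u where "\<not> holds ?V t0 u c0 0 a' 0"
      using ex t0 by blast
    then have "c0 = 0"
      by (simp add: program_wrong_def)
    have T: "\<exists>u\<in>T. \<not> holds ?V t u 0 a (Suc a) b" if "t \<in> T" for t a b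
    proof -
      obtain a' where a': "\<forall>b. \<forall>t\<in>T. \<exists>u\<in>T. \<not> holds ?V t u 0 a a' b"
        using ex \<open>c0 = 0\<close> by blast
      \<comment> \<open>The choice \<open>b = Suc a\<close> excludes
        \<open>Suc a < a'\<close>.\<close>
      obtain u where "\<not> holds ?V t0 u 0 a a' (Suc a)"
        using a' t0 by blast
      then have "a < a' \<and> \<not> Suc a < a'"
        by (simp add: program_wrong_def)
      then have "a' = Suc a"
        by simp
      then show ?thesis
        using a' that by blast
    qed
    note T = T[unfolded V holds_program_wrong]
    have marked: "\<exists>u\<in>T. mark \<in> u n" for n
      using T[OF t0, of n 0] by blast
    have unique: "a = b" if "t \<in> T" "mark \<in> t a" "mark \<in> t b" for t a b
      using T[OF that(1), of a b] that by blast
    \<comment> \<open>The induction generalises over \<open>t\<close>: as all traces marked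
      \<open>n\<close> agree, it does not matter that the witness changes with
      \<open>b\<close>.\<close>
    have row: "reads t (new m) (S n m)" if "t \<in> T" "mark \<in> t n" "m < ?M" for t n m
      using that
    proof (induction n arbitrary: t m)
      case 0
      have "\<not> holds (chain_wrong x) t t 0 a (Suc a) b" for a b
        using T[OF 0(1), of a b] holds_chain_wrong_cong[of x t _ 0 a "Suc a" b t] by blast
      then have "reads t (inp x) x"
        using holds_chain_wrong[of x t t] by blast
      then have "reads t (new 0) x"
        using T[OF 0(1)] 0(2) unfolding reads_def by blast
      moreover have "reads t (new m) (S 0 m)" if "0 < m"
      proof -
        have "\<not> holds (wrong m (start_value ks K c m)) t t 0 a (Suc a) b" for a b
        proof -
          have "m \<in> {1..<?M}"
            using that 0(3) by simp
          then show ?thesis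
            using T[OF 0(1), of a b] 0(2) holds_wrong_cong[of m _ t _ 0 a "Suc a" b t] by blast
        qed
        then show ?thesis
          using init[OF that] by blast
      qed
      ultimately show ?case
        using S_0(1) by (cases "m = 0") auto
    next
      case (Suc n)
      have "reads t (old m) (S n m)" if m: "m < ?M" for m
        unfolding reads_def
      proof
        fix b
        obtain u where "u \<in> T" "mark \<in> u n" "old m \<in> t b \<longleftrightarrow> new m \<in> u b"
          using T[OF Suc.prems(1), of n b] Suc.prems(2) m by blast
        then show "old m \<in> t b \<longleftrightarrow> b < S n m"
          using Suc.IH[of u m] m unfolding reads_def by blast
      qed
      \<comment> \<open>The mark of \<open>t\<close> is unique, so \<open>t\<close> is not an
        initial trace and the step clause applies.\<close>
      moreover have "mark \<notin> t 0"
        using unique[OF Suc.prems(1)] Suc.prems(2) by blast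
      then have "\<not> holds (wrong_step ks K) t t 0 a (Suc a) b" for a b
        using T[OF Suc.prems(1), of a b] holds_wrong_step_cong[of ks K t _ 0 a "Suc a" b t] by blast
      ultimately show ?case
        using holds_wrong_step[OF wf state[of n], of t t] Suc.prems(3) unfolding S_def cfg_Suc by blast
    qed
    show ?R
    proof
      fix n
      obtain t where t: "t \<in> T" "mark \<in> t n"
        using marked by blast
      then show "fst (cfg n) = [] \<longrightarrow> snd (cfg n) 1 = 0"
        using bad[of t n] row[OF t] T[OF t(1)] by blast
    qed
  next
    assume R: ?R
    have "{mark} \<union> new ` {..<?M} \<union> old ` {..<?M} \<union> inp ` {..x} \<subseteq> props ?V"
      by (auto simp: program_wrong_def copy_wrong_def input_wrong_def props_chain_wrong)
    then have names: "mark \<in> X" "\<And>m. m < ?M \<Longrightarrow> new m \<in> X" "\<And>m. m < ?M \<Longrightarrow> old m \<in> X"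
      "\<And>j. j \<le> x \<Longrightarrow> inp j \<in> X"
      using X by blast+
    \<comment> \<open>At \<open>n = 0\<close> the truncated \<open>n - 1\<close> is a harmless
      default, because the copy and step clauses concern positive marks only. Intersecting with
      \<open>X\<close> makes the rows traces over \<open>X\<close>; by \<open>names\<close> no
      relevant proposition is lost.\<close>
    define row :: "nat \<Rightarrow> trace" where "row n i = X \<inter> ({p. p = mark \<and> i = n} \<union>
      {new m |m. i < S n m} \<union> {old m |m. i < S (n - 1) m} \<union> {inp j |j. i < j})" for n i
    have row_simps: "mark \<in> row n i \<longleftrightarrow> i = n" for n i
      using names by (auto simp: row_def)
    have new: "\<forall>m<?M. reads (row n) (new m) (S n m)" for n
      using names by (auto simp: row_def reads_def)
    have old: "\<forall>m<?M. reads (row n) (old m) (S (n - 1) m)" for n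
      using names by (auto simp: row_def reads_def)
    have "\<forall>j\<le>x. reads (row n) (inp j) j" for n
      using names by (auto simp: row_def reads_def)
    then have chain: "reads (row n) (inp x) x" "\<not> holds (chain_wrong x) (row n) u 0 a (Suc a) b" for n u a b
      using holds_chain_wrong[of x "row n" u] by auto
    \<comment> \<open>The witness is always \<open>row a\<close>: it is marked \<open>a\<close>, and
      for \<open>n = Suc a\<close> it precedes \<open>row n\<close> in the run.\<close>
    have "\<not> holds ?V (row n) (row a) 0 a (Suc a) b" for n a b
      unfolding V holds_program_wrong row_simps
    proof (intro conjI impI)
      show "\<forall>m<?M. old m \<in> row n b \<longleftrightarrow> new m \<in> row a b" if "Suc a = n"
        using that new[of a] old[of n] by (auto simp: reads_def)
      show "\<forall>m\<in>{1..<?M}. \<not> holds (wrong m (start_value ks K c m)) (row n) (row a) 0 a (Suc a) b"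
        if "0 = n"
      proof
        fix m
        assume "m \<in> {1..<?M}"
        then show "\<not> holds (wrong m (start_value ks K c m)) (row n) (row a) 0 a (Suc a) b"
          using init[of m "row n" "row a"] new[of n] that by auto
      qed
      show "\<not> holds (wrong_step ks K) (row n) (row a) 0 a (Suc a) b" if n: "0 \<noteq> n"
      proof -
        obtain l where l: "n = Suc l"
          using n by (cases n) simp_all
        have "reads (row n) (old m) (store ks K (cfg l) m)" if "m < ?M" for m
          using old[of n] that by (simp add: l S_def)
        from holds_wrong_step[OF wf state this, of "row a"] show ?thesis
          using new[of n] unfolding l S_def cfg_Suc by blast
      qed
      show "\<not> ((\<exists>j<length ks. ks ! j = [] \<and> new (K + j) \<in> row n 0) \<and> new 1 \<in> row n 0)"
        using bad[OF new] R by blast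
      show "new 0 \<in> row n b \<longleftrightarrow> inp x \<in> row n b" if "0 = n"
        using new[of 0] chain(1)[of n] S_0(1) that K by (auto simp: reads_def)
    qed (use chain in auto)
    then have "\<forall>a. \<forall>b. \<forall>t\<in>range row. \<exists>u\<in>range row. \<not> holds ?V t u 0 a (Suc a) b"
      by blast
    moreover have "range row \<subseteq> traces X"
      by (auto simp: row_def traces_def)
    ultimately show "\<exists>T. T \<subseteq> traces X \<and> T \<noteq> {} \<and>
      (\<exists>c. \<forall>a. \<exists>a'. \<forall>b. \<forall>t\<in>T. \<exists>u\<in>T. \<not> holds ?V t u c a a' b)"
      by (intro exI[of _ "range row"]) blast
  qed
  finally show ?thesis .
qed

text \<open>Stated for all large \<open>K\<close>, so that the bounds for finitely many control
  states can be combined.\<close>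

lemma bounded_regs:
  "\<forall>\<^sub>F K in at_top. tested k < K \<and> (\<forall>m<K. exp_regs (assigned k m) \<subseteq> {..<K})"
proof (cases "\<exists>r e k'. k = Asg r e # k'")
  case True
  then obtain r e k' where k: "k = Asg r e # k'" by blast
  have "finite (exp_regs e)"
    by (cases e) auto
  then obtain N where "exp_regs e \<subseteq> {..<N}"
    by (auto simp: finite_nat_set_iff_bounded)
  then have "tested k < K \<and> (\<forall>m<K. exp_regs (assigned k m) \<subseteq> {..<K})" if "Suc N \<le> K" for K
    using that by (auto simp: k)
  then show ?thesis
    unfolding eventually_at_top_linorder by blast
next
  case False
  then have "assigned k m = Copy m" for m
    by (cases "(k, m)" rule: assigned.cases) auto
  then have "tested k < K \<and> (\<forall>m<K. exp_regs (assigned k m) \<subseteq> {..<K})" if "Suc (tested k) \<le> K" for K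
    using that by auto
  then show ?thesis
    unfolding eventually_at_top_linorder by blast
qed

text \<open>With nothing after \<open>c\<close>, only \<open>[]\<close> could leave the set of
  continuations, and \<open>nxt\<close> fixes \<open>[]\<close>. The bound 2 makes room for the
  input register 0 and the output register 1.\<close>

lemma ex_wf_states: "\<exists>ks K. wf_states ks K \<and> c \<in> set ks \<and> 2 \<le> K"
proof -
  obtain ks where ks: "set ks = continuations c []" "distinct ks"
    using finite_distinct_list[OF finite_continuations] by blast
  have "\<forall>\<^sub>F K in at_top. \<forall>k\<in>set ks. tested k < K \<and> (\<forall>m<K. exp_regs (assigned k m) \<subseteq> {..<K})"
    using bounded_regs by (simp add: eventually_ball_finite)
  then have "\<forall>\<^sub>F K in at_top. 2 \<le> K \<and>
    (\<forall>k\<in>set ks. tested k < K \<and> (\<forall>m<K. exp_regs (assigned k m) \<subseteq> {..<K}))"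
    using eventually_ge_at_top by (rule eventually_conj[rotated])
  then obtain K where "2 \<le> K"
    "\<forall>k\<in>set ks. tested k < K \<and> (\<forall>m<K. exp_regs (assigned k m) \<subseteq> {..<K})"
    by (auto dest: eventually_happens)
  moreover have "nxt k z \<in> set ks" if "k \<in> set ks" for k z
    using that nxt_in_continuations[of k c "[]" z] unfolding ks by (cases "k = []") auto
  moreover have "c \<in> set ks"
    using start_in_continuations[of c "[]"] by (simp add: ks)
  ultimately show ?thesis
    using ks(2) unfolding wf_states_def by blast
qed

section \<open>Computability of the reduction\<close>

text \<open>The type of \<open>a\<close> is arbitrary: if \<open>A\<close> returns codes of
  formulas, functions on formulas can be treated without decoding.\<close>

definition recursive_in :: "('a \<Rightarrow> nat list) \<Rightarrow> ('a \<Rightarrow> nat) \<Rightarrow> bool" where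
  "recursive_in A h \<longleftrightarrow> (\<exists>f. \<forall>a. eval f (A a) (h a))"

lemma recursive_in_nth: "(\<And>a. i < length (A a)) \<Longrightarrow> recursive_in A (\<lambda>a. A a ! i)"
  unfolding recursive_in_def by (auto intro: eval.Proj)

lemma recursive_in_comp1:
  assumes "recursive_in (\<lambda>n. [n]) h" "recursive_in A g"
  shows "recursive_in A (\<lambda>a. h (g a))"
proof -
  obtain f f' where "\<forall>n. eval f [n] (h n)" "\<forall>a. eval f' (A a) (g a)"
    using assms unfolding recursive_in_def by blast
  then have "\<forall>a. eval (Comp f [f']) (A a) (h (g a))"
    by (auto intro: eval.Comp[of _ _ "[_]"])
  then show ?thesis
    unfolding recursive_in_def by blast
qed

lemma recursive_in_comp2:
  assumes "recursive_in (\<lambda>(m, n). [m, n]) (\<lambda>(m, n). h m n)" "recursive_in A g" "recursive_in A g'"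
  shows "recursive_in A (\<lambda>a. h (g a) (g' a))"
proof -
  obtain f e e' where "\<forall>m n. eval f [m, n] (h m n)" "\<forall>a. eval e (A a) (g a)" "\<forall>a. eval e' (A a) (g' a)"
    using assms unfolding recursive_in_def by auto
  then have "\<forall>a. eval (Comp f [e, e']) (A a) (h (g a) (g' a))"
    by (auto intro: eval.Comp[of _ _ "[_, _]"])
  then show ?thesis
    unfolding recursive_in_def by blast
qed

lemma recursive_in_Suc:
  assumes "recursive_in A h"
  shows "recursive_in A (\<lambda>a. Suc (h a))"
  by (rule recursive_in_comp1[OF _ assms]) (auto simp: recursive_in_def intro: eval.Succ)

lemma recursive_in_const: "recursive_in A (\<lambda>_. n)"
proof (induction n)
  case 0
  show ?case
    unfolding recursive_in_def by (auto intro: eval.Zero)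
next
  case (Suc n)
  then show ?case
    by (rule recursive_in_Suc)
qed

text \<open>The step is evaluated only on the lists \<open>[n, h n]\<close> that occur in the
  recursion, so nothing has to be said about other second arguments.\<close>

lemma recursive_in_rec:
  assumes "recursive_in (\<lambda>n. [n, h n]) (\<lambda>n. h (Suc n))"
  shows "recursive_in (\<lambda>n. [n]) h"
proof -
  obtain g where g: "\<And>n. eval g [n, h n] (h (Suc n))"
    using assms unfolding recursive_in_def by blast
  obtain f where f: "eval f [] (h 0)"
    using recursive_in_const[of "\<lambda>_ :: unit. []" "h 0"] unfolding recursive_in_def by blast
  have "eval (PrimRec f g) [n] (h n)" for n
    by (induction n) (auto intro: eval.PrimRec_0 f eval.PrimRec_Suc g)
  then show ?thesis
    unfolding recursive_in_def by blast
qed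

lemma recursive_in_add:
  assumes "recursive_in A g" "recursive_in A h"
  shows "recursive_in A (\<lambda>a. g a + h a)"
proof (rule recursive_in_comp2[OF _ assms])
  have "eval (PrimRec (Proj 0) (Comp Succ [Proj 1])) [m, n] (m + n)" for m n
  proof (induction m)
    case 0
    show ?case
      using eval.Proj[of 0 "[n]"] by (auto intro: eval.PrimRec_0)
  next
    case (Suc m)
    have "eval (Comp Succ [Proj 1]) [m, m + n, n] (Suc (m + n))"
      using eval.Proj[of 1 "[m, m + n, n]"] by (auto intro!: eval.Comp[of _ _ "[_]"] eval.Succ)
    then show ?case
      using Suc by (auto intro: eval.PrimRec_Suc)
  qed
  then show "recursive_in (\<lambda>(m, n). [m, n]) (\<lambda>(m, n). m + n)"
    unfolding recursive_in_def by auto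
qed

lemma recursive_in_prod_encode:
  assumes "recursive_in A g" "recursive_in A h"
  shows "recursive_in A (\<lambda>a. prod_encode (g a, h a))"
proof -
  have "recursive_in (\<lambda>n. [n, triangle n]) (\<lambda>n. triangle (Suc n))"
    using recursive_in_nth[of 0 "\<lambda>n. [n, triangle n]"] recursive_in_nth[of 1 "\<lambda>n. [n, triangle n]"]
    by (simp add: recursive_in_add recursive_in_Suc del: add_Suc_right)
  then have "recursive_in (\<lambda>n. [n]) triangle"
    by (rule recursive_in_rec)
  from recursive_in_add[OF recursive_in_comp1[OF this recursive_in_add[OF assms]] assms(1)]
  show ?thesis
    by (simp add: prod_encode_def)
qed

lemma recursive_in_forms:
  assumes "recursive_in A (\<lambda>a. encode_form (\<phi> a))"
  shows "recursive_in A (\<lambda>a. encode_form (Neg (\<phi> a)))"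
    and "recursive_in A (\<lambda>a. encode_form (ExU p (\<phi> a)))"
    and "recursive_in A (\<lambda>a. encode_form (ExT p (\<phi> a)))"
    and "recursive_in A (\<lambda>a. encode_form (ExTime p (\<phi> a)))"
    and "recursive_in A (\<lambda>a. encode_form (\<psi> a)) \<Longrightarrow> recursive_in A (\<lambda>a. encode_form (Or (\<phi> a) (\<psi> a)))"
  using assms by (simp_all add: recursive_in_prod_encode recursive_in_const)

lemma recursive_in_And:
  "recursive_in A (\<lambda>a. encode_form (\<phi> a)) \<Longrightarrow> recursive_in A (\<lambda>a. encode_form (\<psi> a)) \<Longrightarrow>
    recursive_in A (\<lambda>a. encode_form (And (\<phi> a) (\<psi> a)))"
  unfolding And_def by (intro recursive_in_forms)

lemma recursive_in_Differ:
  "recursive_in A (\<lambda>a. encode_form (\<phi> a)) \<Longrightarrow> recursive_in A (\<lambda>a. encode_form (\<psi> a)) \<Longrightarrow>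
    recursive_in A (\<lambda>a. encode_form (Differ (\<phi> a) (\<psi> a)))"
  unfolding Differ_def by (intro recursive_in_forms recursive_in_And)

lemma recursive_in_sentence:
  "recursive_in A (\<lambda>a. encode_form (\<phi> a)) \<Longrightarrow> recursive_in A (\<lambda>a. encode_form (sentence (\<phi> a)))"
  unfolding sentence_def by (intro recursive_in_forms)

lemma recursive_in_mult_4:
  assumes "recursive_in A h"
  shows "recursive_in A (\<lambda>a. 4 * h a)"
proof -
  have "4 * h a = (h a + h a) + (h a + h a)" for a
    by simp
  then show ?thesis
    using assms by (simp only: recursive_in_add)
qed

lemma recursive_in_Holds_inp:
  "recursive_in A h \<Longrightarrow> recursive_in A (\<lambda>a. encode_form (Holds (inp (h a)) p i))"
  by (simp add: inp_def recursive_in_prod_encode recursive_in_const recursive_in_add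
      recursive_in_mult_4 del: add_Suc_right)

lemma recursive_in_input_wrong:
  assumes "recursive_in A h"
  shows "recursive_in A (\<lambda>a. encode_form (input_wrong (h a)))"
proof -
  let ?A = "\<lambda>n. [n, encode_form (chain_wrong n)]"
  have "recursive_in ?A (\<lambda>n. n)" "recursive_in ?A (\<lambda>n. encode_form (chain_wrong n))"
    using recursive_in_nth[of 0 ?A] recursive_in_nth[of 1 ?A] by simp_all
  then have "recursive_in ?A (\<lambda>n. encode_form (chain_wrong (Suc n)))"
    unfolding chain_wrong.simps
    by (intro recursive_in_forms recursive_in_Differ recursive_in_Holds_inp recursive_in_Suc)
  then have "recursive_in (\<lambda>n. [n]) (\<lambda>n. encode_form (chain_wrong n))"
    by (rule recursive_in_rec)
  from recursive_in_comp1[OF this assms] show ?thesis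
    unfolding input_wrong_def
    by (intro recursive_in_forms recursive_in_And recursive_in_Differ recursive_in_Holds_inp
        recursive_in_const assms)
qed

lemma Suc_set_encode_lessThan: "Suc (set_encode {..<n}) = 2 ^ n"
  by (induction n) (simp_all add: set_encode_def)

lemma recursive_in_set_encode_lessThan:
  assumes "recursive_in A h"
  shows "recursive_in A (\<lambda>a. set_encode {..<h a})"
proof (rule recursive_in_comp1[OF recursive_in_rec assms])
  let ?A = "\<lambda>n. [n, set_encode {..<n}]"
  \<comment> \<open>This is \<open>2 ^ (n + 1) - 1 = 2 * (2 ^ n - 1) + 1\<close>.\<close>
  have "set_encode {..<Suc n} = Suc (set_encode {..<n} + set_encode {..<n})" for n
    using Suc_set_encode_lessThan[of n] Suc_set_encode_lessThan[of "Suc n"] by simp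
  then show "recursive_in ?A (\<lambda>n. set_encode {..<Suc n})"
    using recursive_in_nth[of 1 ?A] by (simp only:) (simp add: recursive_in_add recursive_in_Suc)
qed

section \<open>Diagonalisation\<close>

text \<open>A superset of the variables suffices: those of the given formula are bounded by its
  code, those of \<open>input_wrong\<close> by the name of the last input proposition.\<close>

definition diagonal :: "hform \<Rightarrow> nat set \<times> hform" where
  "diagonal \<phi> = ({..<4 * encode_form \<phi> + 4},
     sentence (Neg (Or \<phi> (input_wrong (encode_form \<phi>)))))"

lemma recursive_in_diagonal:
  "recursive_in (\<lambda>\<phi>. [encode_form \<phi>]) (\<lambda>\<phi>. encode_instance (diagonal \<phi>))"
proof -
  have "recursive_in (\<lambda>\<phi>. [encode_form \<phi>]) encode_form"
    using recursive_in_nth[of 0 "\<lambda>\<phi>. [encode_form \<phi>]"] by simp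
  then show ?thesis
    unfolding diagonal_def encode_instance.simps
    by (intro recursive_in_prod_encode recursive_in_set_encode_lessThan recursive_in_add
        recursive_in_mult_4 recursive_in_const recursive_in_sentence recursive_in_forms
        recursive_in_input_wrong)
qed

text \<open>Both components of a pair are bounded by its code under
  \<open>prod_encode\<close>.\<close>

lemma props_le_encode_form: "x \<in> props \<phi> \<Longrightarrow> x \<le> encode_form \<phi>"
proof -
  have "x \<le> m \<Longrightarrow> x \<le> prod_encode (m, n)" "x \<le> n \<Longrightarrow> x \<le> prod_encode (m, n)" for m n
    using order_trans[OF _ le_prod_encode_1] order_trans[OF _ le_prod_encode_2] by blast+
  then show "x \<in> props \<phi> \<Longrightarrow> x \<le> encode_form \<phi>"
    by (induction \<phi>) auto
qed

lemma props_diagonal: "props (Or \<phi> (input_wrong (encode_form \<phi>))) \<subseteq> fst (diagonal \<phi>)"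
  using props_le_encode_form[of _ \<phi>]
  by (fastforce simp: diagonal_def input_wrong_def props_chain_wrong mark_def new_def inp_def)

lemma step_halted: "(step ^^ n) ([], s) = ([], s)"
  by (induction n) auto

text \<open>Halting configurations are fixed points of \<open>step\<close>, so both agree with the
  configuration after \<open>m + n\<close> steps.\<close>

lemma halted_unique:
  assumes "(step ^^ m) cfg = ([], s)" "(step ^^ n) cfg = ([], t)"
  shows "s = t"
proof -
  have "(step ^^ (n + m)) cfg = ([], s)" "(step ^^ (m + n)) cfg = ([], t)"
    unfolding funpow_add using assms by (simp_all add: step_halted)
  then show ?thesis
    by (simp add: add.commute)
qed

theorem theorem6:
  "\<not> decidable_problem encode_instance
     {(X, \<phi>). finite X \<and> props \<phi> \<subseteq> X \<and> time_prefixed \<phi> \<and> closed_form \<phi> \<and>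
        (\<exists>i\<^sub>1 i\<^sub>2 i\<^sub>3 i\<^sub>4 i\<^sub>5 p\<^sub>1 p\<^sub>2 p\<^sub>3 p\<^sub>4 \<phi>'.
           distinct [i\<^sub>1, i\<^sub>2, i\<^sub>3, i\<^sub>4, i\<^sub>5] \<and> distinct [p\<^sub>1, p\<^sub>2, p\<^sub>3, p\<^sub>4] \<and> quantifier_free \<phi>' \<and>
           \<phi> = ExTime i\<^sub>1 (AllTime i\<^sub>2 (ExTime i\<^sub>3 (ExTime i\<^sub>4 (AllTime i\<^sub>5
                 (AllT p\<^sub>1 (ExT p\<^sub>2 (ExT p\<^sub>3 (ExU p\<^sub>4 \<phi>')))))))))}
     {(X, \<phi>). \<exists>T \<in> language X \<phi>. T \<noteq> {}}"
    (is "\<not> decidable_problem _ ?insts ?yes")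
proof
  assume "decidable_problem encode_instance ?insts ?yes"
  then obtain f where f: "\<forall>a\<in>?insts. eval f [encode_instance a] (if a \<in> ?yes then 1 else 0)"
    unfolding decidable_problem_def by (rule exE)
  obtain e where e: "\<And>\<phi>. eval e [encode_form \<phi>] (encode_instance (diagonal \<phi>))"
    using recursive_in_diagonal unfolding recursive_in_def by blast
  \<comment> \<open>Input in register 0, output in register 1, scratch from 2 on. On the code of a
    formula, \<open>Comp f [e]\<close> gives the verdict of \<open>f\<close> on the diagonal
    instance.\<close>
  obtain c where c: "implements (Comp f [e]) [0] 1 2 c"
    using ex_implements[of "[0]" 2 1 "Comp f [e]"] by auto
  obtain ks K where K: "wf_states ks K" "c \<in> set ks" "2 \<le> K"
    using ex_wf_states by blast
  define \<phi> where "\<phi> = program_wrong ks K c"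
  \<comment> \<open>The formula depends on the program but not on its input, so its own code can
    serve as input.\<close>
  define x where "x = encode_form \<phi>"
  define s :: "nat \<Rightarrow> nat" where "s = (\<lambda>_. 0)(0 := x)"
  let ?\<psi> = "Or \<phi> (input_wrong x)"
  have matrix: "matrix ?\<psi>"
    by (simp add: \<phi>_def)
  have insts: "diagonal \<phi> \<in> ?insts"
    unfolding diagonal_def x_def[symmetric] mem_Collect_eq case_prod_conv
  proof (intro conjI)
    show "props (sentence (Neg ?\<psi>)) \<subseteq> {..<4 * x + 4}"
      using props_diagonal[of \<phi>] by (simp add: sentence_def diagonal_def x_def)
    show "\<exists>i\<^sub>1 i\<^sub>2 i\<^sub>3 i\<^sub>4 i\<^sub>5 p\<^sub>1 p\<^sub>2 p\<^sub>3 p\<^sub>4 \<phi>'.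
           distinct [i\<^sub>1, i\<^sub>2, i\<^sub>3, i\<^sub>4, i\<^sub>5] \<and> distinct [p\<^sub>1, p\<^sub>2, p\<^sub>3, p\<^sub>4] \<and> quantifier_free \<phi>' \<and>
           sentence (Neg ?\<psi>) = ExTime i\<^sub>1 (AllTime i\<^sub>2 (ExTime i\<^sub>3 (ExTime i\<^sub>4 (AllTime i\<^sub>5
                 (AllT p\<^sub>1 (ExT p\<^sub>2 (ExT p\<^sub>3 (ExU p\<^sub>4 \<phi>'))))))))"
      unfolding sentence_def
      by (rule exI[of _ 0], rule exI[of _ 1], rule exI[of _ 2], rule exI[of _ 3], rule exI[of _ 4],
          rule exI[of _ 0], rule exI[of _ 1], rule exI[of _ 2], rule exI[of _ 3],
          rule exI[of _ "Neg ?\<psi>"])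
        (use matrix_quantifier_free[OF matrix] in simp)
  qed (use sentence_time_prefixed[OF matrix] sentence_closed[OF matrix] in simp_all)
  define v :: nat where "v = (if diagonal \<phi> \<in> ?yes then 1 else 0)"
  have "eval f [encode_instance (diagonal \<phi>)] v"
    unfolding v_def by (rule bspec[OF f insts])
  then have "eval (Comp f [e]) (map s [0]) v"
    using e[of \<phi>] by (auto simp: s_def x_def intro: eval.Comp[of _ _ "[_]"])
  from implementsD[OF c this] obtain t where t: "exec c s t" "t 1 = v"
    by metis
  obtain n where n: "(step ^^ n) (c, s) = ([], t)"
    using t(1) unfolding exec_def by (metis append_Nil2)
  have "diagonal \<phi> \<in> ?yes \<longleftrightarrow> (\<forall>n. fst ((step ^^ n) (c, s)) = [] \<longrightarrow> snd ((step ^^ n) (c, s)) 1 = 0)"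
    using program_input_nonempty_iff[OF K, of x "{..<4 * x + 4}"] props_diagonal[of \<phi>]
    by (simp add: diagonal_def x_def[symmetric] \<phi>_def[symmetric] s_def del: language_def)
  \<comment> \<open>A halted run stays where it is, so \<open>t\<close> is the only register content
    to be checked.\<close>
  also have "\<dots> \<longleftrightarrow> t 1 = 0"
    using halted_unique[OF n] n by (metis fst_conv snd_conv prod.collapse)
  \<comment> \<open>By its definition \<open>v\<close> is nonzero iff the diagonal instance is a
    yes-instance, the opposite of the equivalence just derived.\<close>
  finally show False
    using t(2) by (simp add: v_def split: if_splits)
qed

end
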